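(* Let $X$ and $Y$ be Banach spaces such that $\Phi_+(X,Y)\neq\emptyset$. (1) If $Y\times Y$ is isomorphic to $Y$, then $\Phi\mathcal{S}(X,Y)=P\Phi_+(X,Y)$. (2) If every infinite dimensional closed subspace of $X$ contains an infinite dimensional closed subspace $N$ such that the quotient $X/N$ embeds in $Y$, then $\mathcal{SS}(X,Y)=\Phi\mathcal{S}(X,Y)$.
   Context: $\mathcal{L}(X,Y)$ denotes the set of bounded linear operators from $X$ into $Y$. For Banach spaces, "isomorphic" means that there is a bijective bounded linear operator (with bounded inverse) between them; a Banach space $Z$ embeds in $Y$ if there are $U\in\mathcal{L}(Z,Y)$ and $c>0$ with $\|Uz\|\ge c\|z\|$ for every $z\in Z$. $Y\times Y$ is endowed with the norm $\|(y_1,y_2)\|_1=\|y_1\|+\|y_2\|$. $T\in\mathcal{L}(X,Y)$ is upper semi-Fredholm, $T\in\Phi_+(X,Y)$, if its range is closed and its kernel is finite dimensional. $T$ is strictly singular, $T\in\mathcal{SS}(X,Y)$, if there is no infinite dimensional closed subspace $M$ of $X$ for which there is $c>0$ with $\|Tm\|\ge c\|m\|$ for all $m\in M$. When $\Phi_+(X,Y)\neq\emptyset$: - the perturbation class is $P\Phi_+(X,Y)=\{K\in\mathcal{L}(X,Y): T+K\in\Phi_+(X,Y)\text{ for each }T\in\Phi_+(X,Y)\}$; - $\Phi\mathcal{S}(X,Y)$ (the $\Phi$-singular operators) is the set of $K\in\mathcal{L}(X,Y)$ such that for each $S\in\mathcal{L}(X,Y)$, $(S,K)\in\Phi_+(X,Y\times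 Y)$ implies $S\in\Phi_+(X,Y)$, where $(S,K):X\to Y\times Y$ is $(S,K)x=(Sx,Kx)$. *)

theory Defs
  imports "HOL-Analysis.Analysis"
begin

text \<open>
  Banach spaces over the real or the complex field are treated simultaneously. A
  \<^emph>\<open>Banach space over \<open>'k\<close>\<close> is a type of class \<open>banach\<close> (complete norm, underlying real structure)
  with a scalar multiplication by \<open>'k\<close> extending the real one. The sort constraint on \<open>'k\<close> is
  satisfied by \<open>real\<close> and \<open>complex\<close>, and (Gelfand--Mazur) by nothing else up to isomorphism.
\<close>

locale banach_over = vector_space s
  for s :: "'k::{real_normed_field,euclidean_space} \<Rightarrow> 'a::banach \<Rightarrow> 'a" +
  assumes norm_scale: "norm (s k x) = norm k * norm x"
    and scale_of_real: "s (of_real r) x = r *\<^sub>R x"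

lemma banach_over_real: "banach_over (scaleR :: real \<Rightarrow> 'a::banach \<Rightarrow> 'a)"
  by unfold_locales (auto simp: algebra_simps)

lemma banach_over_complex: "banach_over ((*) :: complex \<Rightarrow> complex \<Rightarrow> complex)"
  by unfold_locales (auto simp: algebra_simps norm_mult scaleR_conv_of_real)

definition bounded_ops ::
    "('k::{real_normed_field,euclidean_space} \<Rightarrow> 'a::banach \<Rightarrow> 'a) \<Rightarrow>
     ('k \<Rightarrow> 'b::banach \<Rightarrow> 'b) \<Rightarrow> ('a \<Rightarrow> 'b) set" where
  "bounded_ops sX sY = {T. Vector_Spaces.linear sX sY T \<and> bounded_linear T}"

definition finite_dim ::
    "('k::{real_normed_field,euclidean_space} \<Rightarrow> 'a::banach \<Rightarrow> 'a) \<Rightarrow> 'a set \<Rightarrow> bool" where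
  "finite_dim s M \<longleftrightarrow> (\<exists>B. finite B \<and> M = module.span s B)"

definition closed_subspace ::
    "('k::{real_normed_field,euclidean_space} \<Rightarrow> 'a::banach \<Rightarrow> 'a) \<Rightarrow> 'a set \<Rightarrow> bool" where
  "closed_subspace s M \<longleftrightarrow> module.subspace s M \<and> closed M"

definition isomorphic_banach ::
    "('k::{real_normed_field,euclidean_space} \<Rightarrow> 'a::banach \<Rightarrow> 'a) \<Rightarrow>
     ('k \<Rightarrow> 'b::banach \<Rightarrow> 'b) \<Rightarrow> bool" where
  "isomorphic_banach sX sY \<longleftrightarrow>
     (\<exists>V\<in>bounded_ops sX sY. bij V \<and> inv V \<in> bounded_ops sY sX)"

text \<open>
  On \<open>Y \<times> Y\<close> the library type carries the norm \<open>sqrt (norm y1 ^ 2 + norm y2 ^ 2)\<close> instead of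
  \<open>norm y1 + norm y2\<close>. These are equivalent by the next lemma, and below \<open>Y \<times> Y\<close> only enters
  through boundedness of operators and closedness of ranges, which agree for equivalent norms.
\<close>

lemma prod_norm_equiv:
  fixes p :: "'b::banach \<times> 'b"
  shows "norm p \<le> norm (fst p) + norm (snd p)"
    and "norm (fst p) + norm (snd p) \<le> 2 * norm p"
  using norm_Pair_le[of "fst p" "snd p"] norm_fst_le[of "fst p" "snd p"]
    norm_snd_le[of "snd p" "fst p"] by auto

abbreviation square_scale ::
    "('k::{real_normed_field,euclidean_space} \<Rightarrow> 'b::banach \<Rightarrow> 'b) \<Rightarrow> 'k \<Rightarrow> 'b \<times> 'b \<Rightarrow> 'b \<times> 'b" where
  "square_scale s \<equiv> module_prod.scale s s"

lemma banach_over_square: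
  assumes "banach_over s"
  shows "banach_over (square_scale s)"
proof -
  interpret banach_over s by fact
  have mp: "module_prod s s"
    by (simp add: module_prod_def module_pair_def module_axioms)
  have eq: "square_scale s k p = (s k (fst p), s k (snd p))" for k p
    by (simp add: module_prod.scale_def[OF mp])
  have "norm (square_scale s k p) = norm k * norm p" for k p
    by (simp add: eq norm_Pair norm_scale power_mult_distrib flip: distrib_left)
       (simp add: real_sqrt_mult norm_prod_def)
  then show ?thesis
    by unfold_locales
      (auto simp: eq scale_right_distrib scale_left_distrib scale_of_real scaleR_prod_def)
qed

definition Phi_plus ::
    "('k::{real_normed_field,euclidean_space} \<Rightarrow> 'a::banach \<Rightarrow> 'a) \<Rightarrow>
     ('k \<Rightarrow> 'b::banach \<Rightarrow> 'b) \<Rightarrow> ('a \<Rightarrow> 'b) set" where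
  "Phi_plus sX sY =
     {T \<in> bounded_ops sX sY. closed (range T) \<and> finite_dim sX {x. T x = 0}}"

definition strictly_singular ::
    "('k::{real_normed_field,euclidean_space} \<Rightarrow> 'a::banach \<Rightarrow> 'a) \<Rightarrow>
     ('k \<Rightarrow> 'b::banach \<Rightarrow> 'b) \<Rightarrow> ('a \<Rightarrow> 'b) set" where
  "strictly_singular sX sY =
     {T \<in> bounded_ops sX sY.
        \<not> (\<exists>M. closed_subspace sX M \<and> \<not> finite_dim sX M \<and>
              (\<exists>c>0. \<forall>m\<in>M. norm (T m) \<ge> c * norm m))}"

definition P_Phi_plus ::
    "('k::{real_normed_field,euclidean_space} \<Rightarrow> 'a::banach \<Rightarrow> 'a) \<Rightarrow>
     ('k \<Rightarrow> 'b::banach \<Rightarrow> 'b) \<Rightarrow> ('a \<Rightarrow> 'b) set" where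
  "P_Phi_plus sX sY =
     {K \<in> bounded_ops sX sY. \<forall>T\<in>Phi_plus sX sY. (\<lambda>x. T x + K x) \<in> Phi_plus sX sY}"

definition Phi_singular ::
    "('k::{real_normed_field,euclidean_space} \<Rightarrow> 'a::banach \<Rightarrow> 'a) \<Rightarrow>
     ('k \<Rightarrow> 'b::banach \<Rightarrow> 'b) \<Rightarrow> ('a \<Rightarrow> 'b) set" where
  "Phi_singular sX sY =
     {K \<in> bounded_ops sX sY. \<forall>S\<in>bounded_ops sX sY.
        (\<lambda>x. (S x, K x)) \<in> Phi_plus sX (square_scale sY) \<longrightarrow> S \<in> Phi_plus sX sY}"

text \<open>
  The quotient \<open>X/N\<close> by a closed subspace \<open>N\<close>: a set of cosets with the quotient norm. Scaling has
  to add \<open>N\<close> again, since for \<open>k = 0\<close> the pointwise multiple of a coset is \<open>{0}\<close> and not \<open>N\<close>.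
\<close>

definition coset :: "'a::banach set \<Rightarrow> 'a \<Rightarrow> 'a set" where
  "coset N x = {x + n |n. n \<in> N}"

definition quotient_space :: "'a::banach set \<Rightarrow> 'a set set" where
  "quotient_space N = range (coset N)"

definition quotient_add :: "'a::banach set \<Rightarrow> 'a set \<Rightarrow> 'a set" where
  "quotient_add C D = {c + d |c d. c \<in> C \<and> d \<in> D}"

definition quotient_scale ::
    "('k::{real_normed_field,euclidean_space} \<Rightarrow> 'a::banach \<Rightarrow> 'a) \<Rightarrow>
     'a set \<Rightarrow> 'k \<Rightarrow> 'a set \<Rightarrow> 'a set" where
  "quotient_scale s N k C = {s k c + n |c n. c \<in> C \<and> n \<in> N}"

definition quotient_norm :: "'a::banach set \<Rightarrow> real" where
  "quotient_norm C = Inf (norm ` C)"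

lemma quotient_operations:
  assumes "banach_over s" and "module.subspace s N"
  shows "quotient_add (coset N x) (coset N y) = coset N (x + y)"
    and "quotient_scale s N k (coset N x) = coset N (s k x)"
proof -
  interpret banach_over s by fact
  note sub = assms(2)
  have N: "m + n \<in> N" "s j m \<in> N" "0 \<in> N" if "m \<in> N" "n \<in> N" for m n j
    using sub that by (auto simp: subspace_add subspace_scale subspace_0)
  have 0: "0 \<in> N" using sub by (rule subspace_0)
  show "quotient_add (coset N x) (coset N y) = coset N (x + y)"
  proof
    show "quotient_add (coset N x) (coset N y) \<subseteq> coset N (x + y)"
    proof
      fix z assume "z \<in> quotient_add (coset N x) (coset N y)"
      then obtain m n where mn: "m \<in> N" "n \<in> N" "z = (x + m) + (y + n)"
        by (auto simp: quotient_add_def coset_def)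
      then have "z = (x + y) + (m + n)" by (simp add: algebra_simps)
      then show "z \<in> coset N (x + y)" using N(1)[OF mn(1,2)] by (auto simp: coset_def)
    qed
    show "coset N (x + y) \<subseteq> quotient_add (coset N x) (coset N y)"
    proof
      fix z assume "z \<in> coset N (x + y)"
      then obtain n where n: "n \<in> N" "z = (x + 0) + (y + n)"
        by (auto simp: coset_def algebra_simps)
      then show "z \<in> quotient_add (coset N x) (coset N y)"
        using 0 unfolding quotient_add_def coset_def by blast
    qed
  qed
  show "quotient_scale s N k (coset N x) = coset N (s k x)"
  proof
    show "quotient_scale s N k (coset N x) \<subseteq> coset N (s k x)"
    proof
      fix z assume "z \<in> quotient_scale s N k (coset N x)"
      then obtain m n where mn: "m \<in> N" "n \<in> N" "z = s k (x + m) + n"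
        by (auto simp: quotient_scale_def coset_def)
      then have "z = s k x + (s k m + n)" by (simp add: scale_right_distrib add.assoc)
      moreover have "s k m + n \<in> N" using mn N by blast
      ultimately show "z \<in> coset N (s k x)" by (auto simp: coset_def)
    qed
    show "coset N (s k x) \<subseteq> quotient_scale s N k (coset N x)"
    proof
      fix z assume "z \<in> coset N (s k x)"
      then obtain n where n: "n \<in> N" "z = s k (x + 0) + n"
        by (auto simp: coset_def)
      then show "z \<in> quotient_scale s N k (coset N x)"
        using 0 unfolding quotient_scale_def coset_def by blast
    qed
  qed
qed

definition quotient_embeds ::
    "('k::{real_normed_field,euclidean_space} \<Rightarrow> 'a::banach \<Rightarrow> 'a) \<Rightarrow> 'a set \<Rightarrow>
     ('k \<Rightarrow> 'b::banach \<Rightarrow> 'b) \<Rightarrow> bool" where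
  "quotient_embeds sX N sY \<longleftrightarrow>
     (\<exists>U :: 'a set \<Rightarrow> 'b.
        (\<forall>C\<in>quotient_space N. \<forall>D\<in>quotient_space N. U (quotient_add C D) = U C + U D) \<and>
        (\<forall>k. \<forall>C\<in>quotient_space N. U (quotient_scale sX N k C) = sY k (U C)) \<and>
        (\<exists>b. \<forall>C\<in>quotient_space N. norm (U C) \<le> b * quotient_norm C) \<and>
        (\<exists>c>0. \<forall>C\<in>quotient_space N. norm (U C) \<ge> c * quotient_norm C))"

end

theory Submission
  imports Defs
begin

text \<open>
  The proof runs through one reformulation. A bounded operator is upper semi-Fredholm iff it is
  proper on bounded sets: every bounded sequence with convergent image has a convergent
  subsequence (\<open>Phi_plus_iff_proper\<close>). This rests on the open mapping theorem for closed ranges and on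
  Riesz' characterisation of finite dimension by compactness. Properness passes from a
  composition to its right factor, and this disposes of the algebraic part.

  (1) Since \<open>T\<close> is a function of \<open>(T + K, K)\<close>, a \<open>\<Phi>\<close>-singular \<open>K\<close> always lies in the perturbation
  class. For the converse let \<open>V\<close> be an isomorphism from \<open>Y \<times> Y\<close> onto \<open>Y\<close>. If \<open>(S, K)\<close> is semi-Fredholm,
  then so is \<open>V (S, K)\<close>. The perturbation class is stable under multiplication from the left, because a
  multiple of any operator on \<open>Y\<close> is a difference of two invertible ones; hence \<open>V (0, K)\<close> may be
  subtracted, and \<open>V (S, 0)\<close> is semi-Fredholm, that is, \<open>S\<close> is.

  (2) Let \<open>K\<close> be strictly singular and \<open>(S, K)\<close> semi-Fredholm. An operator that is not
  semi-Fredholm is arbitrarily small on infinite-dimensional closed subspaces, even inside a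
  given subspace of finite codimension (\<open>not_proper_small_subspace\<close>), whereas a semi-Fredholm operator is
  bounded below on some subspace of finite codimension (\<open>proper_bounded_below_on_kernels\<close>). So if \<open>S\<close>
  were not semi-Fredholm, \<open>K\<close> alone would be bounded below on an infinite-dimensional subspace.
  Both facts come from one construction, a sequence of unit vectors each annihilated by
  norming functionals of its predecessors (\<open>triangular_system\<close>); norming functionals are supplied by the
  Hahn--Banach theorem. Real-linear functionals suffice for both scalar fields.
  Conversely, let \<open>K\<close> be bounded below on the infinite-dimensional \<open>M\<close>, and let \<open>S\<close> be the quotient map by
  \<open>N \<subseteq> M\<close> followed by an embedding of the quotient into \<open>Y\<close>. Then \<open>(S, K)\<close> is bounded below, but \<open>S\<close> has
  the infinite-dimensional kernel \<open>N\<close>, so \<open>K\<close> is not \<open>\<Phi>\<close>-singular.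
\<close>

section \<open>Norming functionals\<close>

text \<open>
  The Hahn--Banach theorem is obtained from minimal sublinear functionals: a sublinear functional
  with none strictly below it is linear. The bound by the norm is part of the predicate because it
  gives \<open>- norm x \<le> p x\<close>, so that all pointwise infima below exist, and makes a linear such
  functional have norm at most 1.
\<close>

definition sublinear_le_norm :: "('a::real_normed_vector \<Rightarrow> real) \<Rightarrow> bool" where
  "sublinear_le_norm p \<longleftrightarrow>
     (\<forall>x y. p (x + y) \<le> p x + p y) \<and> (\<forall>t>0. \<forall>x. p (t *\<^sub>R x) = t * p x) \<and> (\<forall>x. p x \<le> norm x)"

lemma sublinear_le_norm_zero:
  assumes "sublinear_le_norm p" shows "p 0 = 0"
proof -
  have "p ((2::real) *\<^sub>R 0) = 2 * p 0"
    using assms unfolding sublinear_le_norm_def by (metis zero_less_numeral)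
  then show ?thesis by simp
qed

lemma sublinear_le_norm_ge:
  assumes "sublinear_le_norm p" shows "- norm x \<le> p x"
proof -
  have "0 \<le> p x + p (- x)"
    using assms sublinear_le_norm_zero[OF assms] unfolding sublinear_le_norm_def
    by (metis add.right_inverse)
  moreover have "p (- x) \<le> norm x"
    using assms unfolding sublinear_le_norm_def by (metis norm_minus_cancel)
  ultimately show ?thesis by simp
qed

text \<open>
  Subadditivity of a pointwise infimum is reduced to a bound for two independently chosen members
  of the family.
\<close>

lemma le_INF_add_INF:
  fixes f g :: "'i \<Rightarrow> real"
  assumes "I \<noteq> {}" "\<And>i j. i \<in> I \<Longrightarrow> j \<in> I \<Longrightarrow> l \<le> f i + g j"
  shows "l \<le> (INF i\<in>I. f i) + (INF i\<in>I. g i)"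
proof -
  have "l - f i \<le> (INF i\<in>I. g i)" if "i \<in> I" for i
    using assms that by (intro cINF_greatest) (auto simp: algebra_simps)
  then have "l - (INF i\<in>I. g i) \<le> (INF i\<in>I. f i)"
    using assms(1) by (intro cINF_greatest) (auto simp: algebra_simps)
  then show ?thesis by simp
qed

lemma INF_mult_pos:
  fixes f :: "'i \<Rightarrow> real"
  assumes "I \<noteq> {}" "bdd_below (f ` I)" "0 < t"
  shows "(INF i\<in>I. t * f i) = t * (INF i\<in>I. f i)"
proof (rule antisym)
  have "(INF i\<in>I. t * f i) / t \<le> (INF i\<in>I. f i)"
  proof (intro cINF_greatest assms)
    fix i assume i: "i \<in> I"
    obtain l where "\<And>i. i \<in> I \<Longrightarrow> l \<le> f i"
      using assms(2) unfolding bdd_below_def by auto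
    then have "bdd_below ((\<lambda>i. t * f i) ` I)"
      using assms(3) by (intro bdd_belowI2[of _ "t * l"]) auto
    then have "(INF i\<in>I. t * f i) \<le> t * f i"
      using i by (rule cINF_lower)
    then show "(INF i\<in>I. t * f i) / t \<le> f i"
      using assms(3) by (simp add: field_simps)
  qed
  then show "(INF i\<in>I. t * f i) \<le> t * (INF i\<in>I. f i)"
    using assms(3) by (simp add: field_simps)
  show "t * (INF i\<in>I. f i) \<le> (INF i\<in>I. t * f i)"
    using assms by (intro cINF_greatest) (auto intro!: cINF_lower)
qed

text \<open>
  Lowering \<open>p\<close> along the direction \<open>z\<close>: the result is again sublinear, lies below \<open>p\<close> (take
  \<open>t = 0\<close>) and is at most \<open>- p z\<close> at \<open>- z\<close> (take \<open>t = 1\<close>).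
\<close>

definition tilt :: "('a::real_normed_vector \<Rightarrow> real) \<Rightarrow> 'a \<Rightarrow> 'a \<Rightarrow> real" where
  "tilt p z y = (INF t\<in>{0..}. p (y + t *\<^sub>R z) - t * p z)"

lemma tilt_bdd_below:
  assumes "sublinear_le_norm p"
  shows "bdd_below ((\<lambda>t. p (y + t *\<^sub>R z) - t * p z) ` {0..})"
proof (rule bdd_belowI2[of _ "- p (- y)"])
  fix t :: real assume t: "t \<in> {0..}"
  have "t * p z = p (t *\<^sub>R z)"
    using assms t sublinear_le_norm_zero[OF assms] unfolding sublinear_le_norm_def
    by (cases "t = 0") auto
  also have "\<dots> \<le> p (y + t *\<^sub>R z) + p (- y)"
    using assms unfolding sublinear_le_norm_def
    by (metis add.commute minus_add_cancel)
  finally show "- p (- y) \<le> p (y + t *\<^sub>R z) - t * p z" by simp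
qed

lemma tilt_le:
  assumes "sublinear_le_norm p" "0 \<le> t"
  shows "tilt p z y \<le> p (y + t *\<^sub>R z) - t * p z"
  unfolding tilt_def using tilt_bdd_below[OF assms(1)] assms(2)
  by (intro cINF_lower) auto

lemma tilt_sublinear_le_norm:
  assumes p: "sublinear_le_norm p"
  shows "sublinear_le_norm (tilt p z)"
proof -
  have "tilt p z (x + y) \<le> tilt p z x + tilt p z y" for x y
  proof -
    have "tilt p z (x + y) \<le> (p (x + s *\<^sub>R z) - s * p z) + (p (y + t *\<^sub>R z) - t * p z)"
      if "0 \<le> s" "0 \<le> t" for s t
    proof -
      have "tilt p z (x + y) \<le> p (x + y + (s + t) *\<^sub>R z) - (s + t) * p z"
        using tilt_le[OF p] that by (metis add_nonneg_nonneg)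
      also have "p (x + y + (s + t) *\<^sub>R z) = p ((x + s *\<^sub>R z) + (y + t *\<^sub>R z))"
        by (simp add: algebra_simps)
      also have "\<dots> \<le> p (x + s *\<^sub>R z) + p (y + t *\<^sub>R z)"
        using p unfolding sublinear_le_norm_def by blast
      finally show ?thesis by (simp add: algebra_simps)
    qed
    then show ?thesis
      unfolding tilt_def[of p z x] tilt_def[of p z y] by (intro le_INF_add_INF) auto
  qed
  moreover have "tilt p z (t *\<^sub>R y) = t * tilt p z y" if t: "0 < t" for t y
  proof -
    have im: "{0..} = (\<lambda>s. t * s) ` {0::real..}"
      using t by (auto simp: image_iff intro!: bexI[of _ "_ / t"])
    have "tilt p z (t *\<^sub>R y) = (INF s\<in>{0..}. p (t *\<^sub>R y + (t * s) *\<^sub>R z) - (t * s) * p z)"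
      unfolding tilt_def by (subst im) (simp add: image_image)
    also have "\<dots> = (INF s\<in>{0..}. t * (p (y + s *\<^sub>R z) - s * p z))"
    proof -
      have "p (t *\<^sub>R y + (t * s) *\<^sub>R z) = t * p (y + s *\<^sub>R z)" for s
        using p t unfolding sublinear_le_norm_def by (metis scaleR_add_right scaleR_scaleR)
      then show ?thesis by (simp add: algebra_simps)
    qed
    also have "\<dots> = t * tilt p z y"
      unfolding tilt_def using tilt_bdd_below[OF p] t by (intro INF_mult_pos) auto
    finally show ?thesis .
  qed
  moreover have "tilt p z y \<le> norm y" for y
    using tilt_le[OF p, of 0 z y] p unfolding sublinear_le_norm_def
    by (simp add: order_trans)
  ultimately show ?thesis unfolding sublinear_le_norm_def by blast
qed

text \<open>
  Zorn's lemma for the reversed pointwise order; the pointwise infimum of a chain is subadditive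
  because any two members of the chain have a smaller one in common.
\<close>

lemma minimal_sublinear:
  assumes q: "sublinear_le_norm q"
  shows "\<exists>p. sublinear_le_norm p \<and> p \<le> q \<and>
           (\<forall>p'. sublinear_le_norm p' \<longrightarrow> p' \<le> p \<longrightarrow> p' = p)"
proof -
  define A where "A = {p. sublinear_le_norm p \<and> p \<le> q}"
  have "\<exists>m\<in>A. \<forall>a\<in>A. a \<le> m \<longrightarrow> a = m"
  proof (rule predicate_Zorn)
    show "partial_order_on A (relation_of (\<lambda>a b. b \<le> a) A)"
      by (rule partial_order_on_relation_ofI) auto
  next
    fix C assume C: "C \<in> Chains (relation_of (\<lambda>a b. b \<le> a) A)"
    then have CA: "p \<in> A" if "p \<in> C" for p
      using that by (auto simp: Chains_def relation_of_def)
    have tot: "p \<le> p' \<or> p' \<le> p" if "p \<in> C" "p' \<in> C" for p p'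
      using C that by (auto simp: Chains_def relation_of_def)
    show "\<exists>u\<in>A. \<forall>a\<in>C. u \<le> a"
    proof (cases "C = {}")
      case True
      then show ?thesis using q by (auto simp: A_def)
    next
      case False
      define u where "u x = (INF p\<in>C. p x)" for x
      have sub: "sublinear_le_norm p" if "p \<in> C" for p
        using CA[OF that] by (simp add: A_def)
      have bdd: "bdd_below ((\<lambda>p. p x) ` C)" for x
        using sub sublinear_le_norm_ge by (intro bdd_belowI2[of _ "- norm x"]) auto
      have lower: "u x \<le> p x" if "p \<in> C" for p x
        unfolding u_def using bdd that by (rule cINF_lower)
      have add: "u (x + y) \<le> u x + u y" for x y
        unfolding u_def[of x] u_def[of y]
      proof (rule le_INF_add_INF[OF False])
        fix p p' assume pp: "p \<in> C" "p' \<in> C"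
        \<comment> \<open>the smaller of the two members of the chain serves both summands\<close>
        obtain m where m: "m \<in> C" "m \<le> p" "m \<le> p'"
          using tot[OF pp] pp by auto
        have "u (x + y) \<le> m (x + y)" using lower m by blast
        also have "\<dots> \<le> m x + m y"
          using sub[OF m(1)] unfolding sublinear_le_norm_def by blast
        also have "\<dots> \<le> p x + p' y"
          using m by (auto simp: le_fun_def intro: add_mono)
        finally show "u (x + y) \<le> p x + p' y" .
      qed
      have scale: "u (t *\<^sub>R x) = t * u x" if t: "0 < t" for t x
      proof -
        have "u (t *\<^sub>R x) = (INF p\<in>C. t * p x)"
          unfolding u_def using sub t by (auto simp: sublinear_le_norm_def intro!: INF_cong)
        then show ?thesis unfolding u_def using INF_mult_pos[OF False bdd t] by simp
      qed
      obtain p0 where p0: "p0 \<in> C" using False by blast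
      have "u x \<le> q x" and "u x \<le> norm x" for x
        using lower[OF p0, of x] CA[OF p0] unfolding A_def sublinear_le_norm_def le_fun_def
        by (auto intro: order_trans)
      then have "u \<in> A"
        using add scale unfolding A_def sublinear_le_norm_def le_fun_def by blast
      then show ?thesis using lower by (auto simp: le_fun_def)
    qed
  qed
  then obtain m where m: "m \<in> A" "\<And>a. a \<in> A \<Longrightarrow> a \<le> m \<Longrightarrow> a = m" by blast
  have "p' = m" if "sublinear_le_norm p'" "p' \<le> m" for p'
    using m that by (auto simp: A_def intro: order_trans)
  then show ?thesis using m by (auto simp: A_def)
qed

text \<open>
  Take \<open>p\<close> minimal below the norm tilted along \<open>x\<close>. Minimality makes every tilt of \<open>p\<close> equal to
  \<open>p\<close>, and \<open>tilt p z y \<le> p (y + z) - p z\<close> then reads \<open>p y + p z \<le> p (y + z)\<close>, so that \<open>p\<close> is additive. The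
  tilt along \<open>x\<close> has pushed \<open>p (- x)\<close> down to \<open>- norm x\<close>, whence \<open>p x = norm x\<close>.
\<close>

lemma norming_functional:
  fixes x :: "'a::real_normed_vector"
  shows "\<exists>f. bounded_linear f \<and> f x = norm x \<and> (\<forall>y. \<bar>f y\<bar> \<le> norm y)"
proof -
  have norm: "sublinear_le_norm (norm :: 'a \<Rightarrow> real)"
    by (auto simp: sublinear_le_norm_def norm_triangle_ineq)
  obtain p where p: "sublinear_le_norm p" and pq: "p \<le> tilt norm x"
    and min: "\<And>p'. sublinear_le_norm p' \<Longrightarrow> p' \<le> p \<Longrightarrow> p' = p"
    using minimal_sublinear[OF tilt_sublinear_le_norm[OF norm, of x]] by blast
  have tilt: "tilt p z = p" for z
    using min tilt_sublinear_le_norm[OF p] tilt_le[OF p, of 0 z] by (auto simp: le_fun_def)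
  have sub: "p (y + z) \<le> p y + p z" for y z
    using p unfolding sublinear_le_norm_def by blast
  have add: "p (y + z) = p y + p z" for y z
    using tilt_le[OF p, of 1 z y] sub[of y z] by (simp add: tilt)
  have ge: "- norm y \<le> p y" and le: "p y \<le> norm y" for y
    using sublinear_le_norm_ge[OF p] p unfolding sublinear_le_norm_def by auto
  have "linear p"
  proof (rule linearI)
    fix t :: real and y
    have pos: "p (s *\<^sub>R y) = s * p y" if "0 < s" for s y
      using p that unfolding sublinear_le_norm_def by blast
    have neg: "p (- y) = - p y" for y
      using add[of y "- y"] sublinear_le_norm_zero[OF p] by simp
    show "p (t *\<^sub>R y) = t *\<^sub>R p y"
      using pos[of t y] pos[of "- t" y] neg[of "t *\<^sub>R y"] sublinear_le_norm_zero[OF p]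
      by (cases "0 < t"; cases "t = 0") auto
  qed (rule add)
  moreover have abs: "\<bar>p y\<bar> \<le> norm y" for y
    using ge[of y] le[of y] by simp
  ultimately have "bounded_linear p"
    by (auto simp: bounded_linear_def bounded_linear_axioms_def intro!: exI[of _ 1])
  moreover have "p x = norm x"
  proof -
    have "p (- x) \<le> tilt norm x (- x)" using pq by (simp add: le_fun_def)
    also have "\<dots> \<le> - norm x" using tilt_le[OF norm, of 1 x "- x"] by simp
    finally show ?thesis
      using add[of x "- x"] sublinear_le_norm_zero[OF p] le[of x] by simp
  qed
  ultimately show ?thesis using abs by blast
qed

section \<open>The open mapping theorem for closed ranges\<close>

text \<open>
  The closed range is a complete metric space covered by the closures of the images of the balls
  of radius \<open>n\<close>, so by Baire one of these closures contains a relative ball.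
\<close>

lemma approx_preimages:
  fixes T :: "'a::banach \<Rightarrow> 'b::banach"
  assumes T: "bounded_linear T" and cl: "closed (range T)"
  shows "\<exists>C>0. \<forall>y\<in>range T. \<forall>e>0. \<exists>x. norm x \<le> C * norm y \<and> norm (y - T x) < e"
proof -
  interpret T: bounded_linear T by fact
  define X where "X = top_of_set (range T)"
  define G where "G n = closure (T ` cball 0 (real n))" for n
  have GR: "G n \<subseteq> range T" for n
    unfolding G_def using cl by (simp add: closure_minimal image_mono)
  have "range T \<subseteq> \<Union>(range G)"
  proof
    fix y assume "y \<in> range T"
    then obtain x where "y = T x" by blast
    moreover obtain n where "norm x \<le> real n" using real_arch_simple by blast
    ultimately have "y \<in> G n" unfolding G_def using closure_subset by fastforce
    then show "y \<in> \<Union>(range G)" by blast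
  qed
  then have "\<Union>(range G) = topspace X" using GR by (auto simp: X_def)
  then have "X interior_of \<Union>(range G) = topspace X" by (simp add: interior_of_topspace)
  moreover have "topspace X \<noteq> {}" by (simp add: X_def)
  moreover have "completely_metrizable_space X"
    unfolding X_def using cl completely_metrizable_space_closedin completely_metrizable_space_euclidean
    by (metis closed_closedin)
  ultimately obtain n where n: "X interior_of G n \<noteq> {}"
    using Baire_category_alt[of X "range G"] GR
    by (force simp: X_def G_def closedin_closed_eq[OF cl])
  then obtain y0 U where y0: "y0 \<in> U" "U \<subseteq> G n" and U: "openin X U"
    unfolding interior_of_def by blast
  then obtain r where r: "r > 0" "\<And>y. y \<in> range T \<Longrightarrow> dist y y0 < r \<Longrightarrow> y \<in> U"
    unfolding X_def openin_euclidean_subtopology_iff by blast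
  have y0R: "y0 \<in> range T" using y0 GR by blast
  define C where "C = 4 * (real n + 1) / r"
  have "\<exists>x. norm x \<le> C * norm y \<and> norm (y - T x) < e" if y: "y \<in> range T" and e: "e > 0" for y e
  proof (cases "y = 0")
    case True
    then show ?thesis using e by (intro exI[of _ 0]) (simp add: T.zero)
  next
    case False
    \<comment> \<open>rescale \<open>y\<close> into the relative ball and take differences with its centre\<close>
    define t where "t = r / (2 * norm y)"
    have t: "t > 0" using r False by (simp add: t_def)
    have ty: "y0 + t *\<^sub>R y \<in> range T"
      using y y0R by (auto simp: image_iff simp flip: T.add T.scaleR)
    have "dist (y0 + t *\<^sub>R y) y0 < r"
      using r False by (simp add: dist_norm t_def)
    then have "y0 + t *\<^sub>R y \<in> G n" using r ty y0 by blast
    then obtain x1 where x1: "norm x1 \<le> n" "dist (T x1) (y0 + t *\<^sub>R y) < t * e / 2"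
      unfolding G_def closure_approachable using t e
      by (metis (no_types, lifting) image_iff mem_cball_0 divide_pos_pos mult_pos_pos zero_less_numeral)
    have "y0 \<in> G n" using y0 by blast
    then obtain x2 where x2: "norm x2 \<le> n" "dist (T x2) y0 < t * e / 2"
      unfolding G_def closure_approachable using t e
      by (metis (no_types, lifting) image_iff mem_cball_0 divide_pos_pos mult_pos_pos zero_less_numeral)
    define x where "x = (1 / t) *\<^sub>R (x1 - x2)"
    have "norm (x1 - x2) \<le> 2 * (real n + 1)"
      using norm_triangle_ineq4[of x1 x2] x1 x2 by simp
    then have "norm x \<le> 2 * (real n + 1) / t"
      using t by (simp add: x_def divide_right_mono)
    also have "\<dots> = C * norm y"
      using False r by (simp add: C_def t_def field_simps)
    finally have 1: "norm x \<le> C * norm y" .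
    have "norm (T x1 - T x2 - t *\<^sub>R y) < t * e"
    proof -
      have "T x1 - T x2 - t *\<^sub>R y = (T x1 - (y0 + t *\<^sub>R y)) - (T x2 - y0)" by simp
      then have "norm (T x1 - T x2 - t *\<^sub>R y) \<le> norm (T x1 - (y0 + t *\<^sub>R y)) + norm (T x2 - y0)"
        by (metis norm_triangle_ineq4)
      then show ?thesis using x1 x2 by (simp add: dist_norm)
    qed
    moreover have "T x1 - T x2 - t *\<^sub>R y = - (t *\<^sub>R (y - T x))"
      using t by (simp add: x_def T.scaleR T.diff algebra_simps)
    ultimately have "t * norm (y - T x) < t * e"
      using t by (metis norm_minus_cancel norm_scaleR abs_of_pos)
    then show ?thesis using 1 t by auto
  qed
  moreover have "C > 0" using r by (simp add: C_def)
  ultimately show ?thesis by blast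
qed

text \<open>
  Correcting an approximate preimage again and again halves the error in each step; the sum of
  the corrections is an exact preimage.
\<close>

lemma bounded_preimages:
  fixes T :: "'a::banach \<Rightarrow> 'b::banach"
  assumes T: "bounded_linear T" and cl: "closed (range T)"
  shows "\<exists>C>0. \<forall>y\<in>range T. \<exists>x. T x = y \<and> norm x \<le> C * norm y"
proof -
  interpret T: bounded_linear T by fact
  obtain C where C: "C > 0"
    and ap: "\<And>y e. y \<in> range T \<Longrightarrow> e > 0 \<Longrightarrow> \<exists>x. norm x \<le> C * norm y \<and> norm (y - T x) < e"
    using approx_preimages[OF T cl] by blast
  have "\<exists>x. norm x \<le> C * norm y \<and> norm (y - T x) \<le> norm y / 2" if y: "y \<in> range T" for y
  proof (cases "y = 0")
    case True
    then show ?thesis by (intro exI[of _ 0]) (simp add: T.zero)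
  next
    case False
    then have "norm y / 2 > 0" by simp
    from ap[OF y this] show ?thesis by (auto intro: less_imp_le)
  qed
  then obtain g where g: "\<And>y. y \<in> range T \<Longrightarrow> norm (g y) \<le> C * norm y"
    "\<And>y. y \<in> range T \<Longrightarrow> norm (y - T (g y)) \<le> norm y / 2"
    by metis
  have "\<exists>x. T x = y \<and> norm x \<le> 2 * C * norm y" if y: "y \<in> range T" for y
  proof -
    define z where "z n = ((\<lambda>u. u - T (g u)) ^^ n) y" for n
    have zS: "z (Suc n) = z n - T (g (z n))" for n by (simp add: z_def)
    have zR: "z n \<in> range T" for n
    proof (induction n)
      case 0
      show ?case using y by (simp add: z_def)
    next
      case (Suc n)
      then show ?case by (auto simp: zS image_iff simp flip: T.diff)
    qed
    have zb: "norm (z n) \<le> norm y * (1/2) ^ n" for n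
    proof (induction n)
      case 0
      show ?case by (simp add: z_def)
    next
      case (Suc n)
      have "norm (z (Suc n)) \<le> norm (z n) / 2" using g(2)[OF zR] by (simp add: zS)
      then show ?case using Suc by simp
    qed
    have gz: "norm (g (z n)) \<le> C * norm y * (1/2) ^ n" for n
    proof -
      have "norm (g (z n)) \<le> C * norm (z n)" using g(1)[OF zR] .
      also have "\<dots> \<le> C * (norm y * (1/2) ^ n)" using zb C by (intro mult_left_mono) auto
      finally show ?thesis by (simp add: mult.assoc)
    qed
    have geo: "(\<lambda>n. C * norm y * (1/2::real) ^ n) sums (C * norm y * 2)"
      using sums_mult[OF geometric_sums[of "1/2::real"], of "C * norm y"] by simp
    have summ: "summable (\<lambda>n. norm (g (z n)))"
      by (rule summable_comparison_test'[OF sums_summable[OF geo], of 0]) (simp add: gz)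
    define x where "x = (\<Sum>n. g (z n))"
    have "norm x \<le> (\<Sum>n. norm (g (z n)))" unfolding x_def by (rule summable_norm[OF summ])
    also have "\<dots> \<le> (\<Sum>n. C * norm y * (1/2) ^ n)"
      by (rule suminf_le[OF gz summ sums_summable[OF geo]])
    also have "\<dots> = 2 * C * norm y" using sums_unique[OF geo] by simp
    finally have nx: "norm x \<le> 2 * C * norm y" .
    have part: "T (\<Sum>i<n. g (z i)) = y - z n" for n
    proof (induction n)
      case 0
      show ?case by (simp add: T.zero z_def)
    next
      case (Suc n)
      then show ?case by (simp add: T.add zS)
    qed
    have "(\<lambda>n. norm y * (1/2::real) ^ n) \<longlonglongrightarrow> 0"
      by (intro tendsto_mult_right_zero LIMSEQ_power_zero) simp
    then have "z \<longlonglongrightarrow> 0"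
      by (rule Lim_null_comparison[rotated]) (simp add: zb)
    then have "(\<lambda>n. T (\<Sum>i<n. g (z i))) \<longlonglongrightarrow> y"
      unfolding part by (auto intro: tendsto_eq_intros)
    moreover have "(\<lambda>n. T (\<Sum>i<n. g (z i))) \<longlonglongrightarrow> T x"
      unfolding x_def using summable_norm_cancel[OF summ]
      by (intro T.tendsto summable_LIMSEQ)
    ultimately have "T x = y" using LIMSEQ_unique by blast
    then show ?thesis using nx by blast
  qed
  then show ?thesis using C by (intro exI[of _ "2 * C"]) auto
qed

section \<open>Finite dimension and compactness\<close>

lemma closed_if_bounded_subseq_limits:
  fixes V :: "'a::real_normed_vector set"
  assumes "\<And>x::nat \<Rightarrow> 'a. range x \<subseteq> V \<Longrightarrow> bounded (range x) \<Longrightarrow>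
    \<exists>r l. strict_mono (r :: nat \<Rightarrow> nat) \<and> l \<in> V \<and> (\<lambda>n. x (r n)) \<longlonglongrightarrow> l"
  shows "closed V"
  unfolding closed_sequential_limits
proof (intro allI impI)
  fix y l assume y: "(\<forall>n. y n \<in> V) \<and> y \<longlonglongrightarrow> l"
  then have "bounded (range y)" by (intro convergent_imp_bounded) auto
  then obtain r l' where r: "strict_mono r" "l' \<in> V" "(\<lambda>n. y (r n)) \<longlonglongrightarrow> l'"
    using assms[of y] y by blast
  then have "(\<lambda>n. y (r n)) \<longlonglongrightarrow> l"
    using LIMSEQ_subseq_LIMSEQ[of y l r] y by (simp add: o_def)
  then show "l \<in> V" using r LIMSEQ_unique by blast
qed

context banach_over
begin

lemma scale_scaleR: "s k (r *\<^sub>R x) = r *\<^sub>R s k x"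
  by (metis scale_of_real scale_left_commute)

lemma bounded_linear_scale: "bounded_linear (s k)"
  by (intro bounded_linear_intro[of _ "norm k"])
    (auto simp: scale_right_distrib scale_scaleR norm_scale mult.commute)

lemma bounded_linear_scale_left: "bounded_linear (\<lambda>k. s k x)"
proof (intro bounded_linear_intro[of _ "norm x"])
  fix r k
  have "s (of_real r * k) x = r *\<^sub>R s k x" by (metis scale_of_real scale_scale)
  then show "s (r *\<^sub>R k) x = r *\<^sub>R s k x" by (simp only: scaleR_conv_of_real)
qed (auto simp: scale_left_distrib norm_scale mult.commute)

lemma subspace_real:
  assumes "subspace V" shows "Real_Vector_Spaces.subspace V"
  using assms scale_of_real
  by (metis real_vector.subspace_def subspace_def)

text \<open>
  Induction on the spanning set. If \<open>b\<close> lies outside the span of \<open>B\<close>, which is closed by the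
  induction hypothesis, then \<open>b\<close> has a positive distance from it, and this bounds the
  \<open>b\<close>-coefficients of a bounded sequence.
\<close>

lemma bounded_span_subseq:
  assumes "finite B"
  shows "range x \<subseteq> span B \<Longrightarrow> bounded (range x) \<Longrightarrow>
    \<exists>r l. strict_mono (r :: nat \<Rightarrow> nat) \<and> l \<in> span B \<and> (\<lambda>n. x (r n)) \<longlonglongrightarrow> l"
  using assms
proof (induction B arbitrary: x rule: finite_induct)
  case empty
  then have "x n = 0" for n by auto
  then show ?case by (intro exI[of _ id] exI[of _ 0]) (simp add: strict_mono_def)
next
  case (insert b B)
  show ?case
  proof (cases "b \<in> span B")
    case True
    then have "span (insert b B) = span B" by (rule span_redundant)
    then show ?thesis using insert by simp
  next
    case False
    have "closed (span B)" by (rule closed_if_bounded_subseq_limits[OF insert.IH])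
    then have "open (- span B)" by (rule open_Compl)
    then obtain d where d: "d > 0" "\<And>v. dist v b < d \<Longrightarrow> v \<notin> span B"
      using False unfolding open_dist by auto
    have "\<exists>k. x n - s k b \<in> span B" for n
      using insert.prems(1) span_breakdown_eq[of "x n" b B] by blast
    then obtain a where a: "\<And>n. x n - s (a n) b \<in> span B" by metis
    \<comment> \<open>dividing \<open>x n\<close> by \<open>a n\<close> exhibits \<open>b\<close> up to a vector of norm \<open>norm (x n) / norm (a n)\<close>\<close>
    have ax: "norm (a n) * d \<le> norm (x n)" for n
    proof (cases "a n = 0")
      case False
      have "s (- inverse (a n)) (x n - s (a n) b) \<in> span B" using a by (rule span_scale)
      moreover have "s (- inverse (a n)) (x n - s (a n) b) = b - s (inverse (a n)) (x n)"
        using False by (simp add: scale_right_diff_distrib)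
      ultimately have "d \<le> dist (b - s (inverse (a n)) (x n)) b"
        using d(2) not_le by metis
      also have "\<dots> = norm (x n) / norm (a n)"
        by (simp add: dist_norm norm_scale norm_inverse divide_inverse mult.commute)
      finally show ?thesis using False by (simp add: field_simps)
    qed simp
    obtain c where c: "\<And>n. norm (x n) \<le> c"
      using insert.prems(2) unfolding bounded_iff by auto
    have "norm (a n) \<le> c / d" for n
      using ax[of n] c[of n] d(1) by (simp add: field_simps)
    then have ab: "bounded (range a)" unfolding bounded_iff by auto
    then obtain r1 la where r1: "strict_mono r1" "(a \<circ> r1) \<longlonglongrightarrow> la"
      using bounded_imp_convergent_subsequence by metis
    define y where "y n = x (r1 n) - s (a (r1 n)) b" for n
    have "bounded (range (\<lambda>n. x (r1 n)))"
      using insert.prems(2) by (auto intro: bounded_subset)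
    moreover have "bounded (range (\<lambda>n. s (a (r1 n)) b))"
      using r1(2) bounded_linear.tendsto[OF bounded_linear_scale_left r1(2)]
      by (intro convergent_imp_bounded) (simp add: o_def)
    ultimately have "bounded (range y)" unfolding y_def by (rule bounded_minus_comp)
    moreover have "range y \<subseteq> span B" using a by (auto simp: y_def)
    ultimately obtain r2 l where r2: "strict_mono r2" "l \<in> span B" "(\<lambda>n. y (r2 n)) \<longlonglongrightarrow> l"
      using insert.IH[of y] by blast
    have "(\<lambda>n. s (a (r1 (r2 n))) b) \<longlonglongrightarrow> s la b"
      using bounded_linear.tendsto[OF bounded_linear_scale_left LIMSEQ_subseq_LIMSEQ[OF r1(2) r2(1)]]
      by (simp add: o_def)
    from tendsto_add[OF r2(3) this] have "(\<lambda>n. x ((r1 \<circ> r2) n)) \<longlonglongrightarrow> l + s la b"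
      by (simp add: y_def)
    moreover have "l + s la b \<in> span (insert b B)"
      using r2(2) by (metis add_diff_cancel_right' span_breakdown_eq)
    ultimately show ?thesis
      using strict_mono_o[OF r1(1) r2(1)] by blast
  qed
qed

lemma closed_span_finite:
  assumes "finite B" shows "closed (span B)"
  by (rule closed_if_bounded_subseq_limits[OF bounded_span_subseq[OF assms]])

end

text \<open>
  Riesz' lemma: subtract an almost nearest point of \<open>V\<close> and normalise.
\<close>

lemma riesz_vector:
  fixes V :: "'a::real_normed_vector set"
  assumes "closed V" "subspace V" "x \<notin> V"
  shows "\<exists>v\<in>V. x \<noteq> v \<and> (\<forall>w\<in>V. 1/2 \<le> norm ((x - v) /\<^sub>R norm (x - v) - w))"
proof -
  have V0: "V \<noteq> {}" using assms(2) subspace_0 by blast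
  then have pos: "infdist x V > 0"
    using assms in_closed_iff_infdist_zero[of V x] infdist_nonneg[of x V] by fastforce
  then have "Inf (dist x ` V) < 2 * infdist x V"
    using infdist_notempty[OF V0, of x] by simp
  then obtain v where v: "v \<in> V" "dist x v < 2 * infdist x V"
    using cInf_lessD[of "dist x ` V"] V0 by blast
  have xv: "x \<noteq> v" using v assms by blast
  have "1/2 \<le> norm ((x - v) /\<^sub>R norm (x - v) - w)" if w: "w \<in> V" for w
  proof -
    have "v + norm (x - v) *\<^sub>R w \<in> V"
      using assms(2) v w by (simp add: subspace_add subspace_scale)
    then have "infdist x V \<le> norm (x - (v + norm (x - v) *\<^sub>R w))"
      using infdist_le by (metis dist_norm)
    also have "x - (v + norm (x - v) *\<^sub>R w) = norm (x - v) *\<^sub>R ((x - v) /\<^sub>R norm (x - v) - w)"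
      using xv by (simp add: algebra_simps)
    finally have "norm (x - v) \<le> 2 * (norm (x - v) * norm ((x - v) /\<^sub>R norm (x - v) - w))"
      using v by (simp add: dist_norm)
    then show ?thesis using xv by simp
  qed
  then show ?thesis using v xv by blast
qed

lemma separated_no_convergent_subseq:
  fixes x :: "nat \<Rightarrow> 'a::real_normed_vector"
  assumes "c > 0" "\<And>m n. m < n \<Longrightarrow> c \<le> norm (x n - x m)" "strict_mono r"
  shows "\<not> convergent (\<lambda>n. x (r n))"
proof
  assume "convergent (\<lambda>n. x (r n))"
  then have "Cauchy (\<lambda>n. x (r n))" by (rule convergent_Cauchy)
  then obtain N where N: "\<And>m n. m \<ge> N \<Longrightarrow> n \<ge> N \<Longrightarrow> dist (x (r m)) (x (r n)) < c"
    using assms(1) unfolding Cauchy_def by blast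
  have "r N < r (Suc N)" using assms(3) by (simp add: strict_mono_def)
  then show False
    using N[of "Suc N" N] assms(2) by (fastforce simp: dist_norm)
qed

text \<open>
  Riesz' characterisation. In infinite dimension, Riesz' lemma yields unit vectors of which each
  has distance at least \<open>1/2\<close> from the span of its predecessors.
\<close>

lemma (in banach_over) finite_dim_iff_compact:
  assumes V: "closed_subspace s V"
  shows "finite_dim s V \<longleftrightarrow>
    (\<forall>x. range x \<subseteq> V \<and> bounded (range x) \<longrightarrow>
       (\<exists>r::nat\<Rightarrow>nat. strict_mono r \<and> convergent (\<lambda>n. x (r n))))"
    (is "_ \<longleftrightarrow> ?compact")
proof
  assume "finite_dim s V"
  then obtain B where B: "finite B" "V = span B" unfolding finite_dim_def by blast
  then show ?compact
    using bounded_span_subseq[OF B(1)] unfolding convergent_def by blast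
next
  assume compact: ?compact
  show "finite_dim s V"
  proof (rule ccontr)
    assume inf: "\<not> finite_dim s V"
    have V': "subspace V" "closed V" using V by (auto simp: closed_subspace_def)
    define P where "P f n u \<longleftrightarrow>
      u \<in> V \<and> norm u = 1 \<and> (\<forall>w\<in>span (f ` {..<n}). 1/2 \<le> norm (u - w))"
      for f :: "nat \<Rightarrow> 'a" and n u
    have "\<exists>x. \<forall>n. P x n (x n)"
    proof (rule dependent_wellorder_choice[of P])
      fix r :: 'a and f g :: "nat \<Rightarrow> 'a" and n
      assume "\<And>i. i < n \<Longrightarrow> f i = g i"
      then have "f ` {..<n} = g ` {..<n}" by auto
      then show "P f n r = P g n r" unfolding P_def by simp
    next
      fix n and f :: "nat \<Rightarrow> 'a"
      assume "\<And>i. i < n \<Longrightarrow> P f i (f i)"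
      then have sub: "span (f ` {..<n}) \<subseteq> V"
        using V' by (intro span_minimal) (auto simp: P_def)
      have "span (f ` {..<n}) \<noteq> V" using inf unfolding finite_dim_def by blast
      then obtain y where y: "y \<in> V" "y \<notin> span (f ` {..<n})" using sub by blast
      obtain v where v: "v \<in> span (f ` {..<n})" "y \<noteq> v"
        "\<And>w. w \<in> span (f ` {..<n}) \<Longrightarrow> 1/2 \<le> norm ((y - v) /\<^sub>R norm (y - v) - w)"
        using riesz_vector[OF closed_span_finite subspace_real[OF subspace_span] y(2)] by auto
      have "(y - v) /\<^sub>R norm (y - v) \<in> V"
        using y v sub V'(1) subspace_real[OF V'(1)]
        by (meson real_vector.subspace_scale subsetD subspace_diff)
      then have "P f n ((y - v) /\<^sub>R norm (y - v))"
        unfolding P_def using v by simp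
      then show "\<exists>u. P f n u" by blast
    qed
    then obtain x where x: "\<And>n. P x n (x n)" by blast
    have "1/2 \<le> norm (x n - x m)" if "m < n" for m n
    proof -
      have "x m \<in> span (x ` {..<n})" using that by (intro span_base) auto
      then show ?thesis using x[of n] unfolding P_def by blast
    qed
    then have "\<not> convergent (\<lambda>n. x (r n))" if "strict_mono r" for r
      using separated_no_convergent_subseq[of "1/2" x r] that by simp
    moreover have "range x \<subseteq> V \<and> bounded (range x)"
      using x unfolding P_def bounded_iff by (metis (no_types, lifting) image_subset_iff order_refl rangeE)
    ultimately show False using compact by blast
  qed
qed

section \<open>Semi-Fredholm operators as proper operators\<close>

text \<open>
  Properness on bounded sets. On the whole space this says that the operator is upper
  semi-Fredholm, and in this form the property passes to right factors of compositions and can be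
  tested on subspaces of finite codimension, without reference to kernels and ranges. The limit of the subsequence need not lie in
  \<open>W\<close>, so \<open>W\<close> may be any subspace.
\<close>

definition proper_on :: "'a::banach set \<Rightarrow> ('a \<Rightarrow> 'b::banach) \<Rightarrow> bool" where
  "proper_on W T \<longleftrightarrow>
     (\<forall>x::nat \<Rightarrow> 'a. range x \<subseteq> W \<and> bounded (range x) \<and> convergent (\<lambda>n. T (x n)) \<longrightarrow>
        (\<exists>r. strict_mono r \<and> convergent (\<lambda>n. x (r n))))"

lemma proper_onD:
  assumes "proper_on W T" "\<And>n. x n \<in> W" "bounded (range x)" "convergent (\<lambda>n. T (x n))"
  obtains r :: "nat \<Rightarrow> nat" and l where "strict_mono r" "(\<lambda>n. x (r n)) \<longlonglongrightarrow> l"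
  using assms unfolding proper_on_def convergent_def by blast

lemma bounded_opsD:
  assumes "T \<in> bounded_ops sX sY"
  shows "bounded_linear T" "Vector_Spaces.linear sX sY T" "T (sX k x) = sY k (T x)"
  using assms unfolding bounded_ops_def by (auto simp: Vector_Spaces.linear_iff)

lemma bounded_opsI:
  assumes "banach_over sX" "banach_over sY" "bounded_linear T" "\<And>k x. T (sX k x) = sY k (T x)"
  shows "T \<in> bounded_ops sX sY"
  using assms unfolding bounded_ops_def Vector_Spaces.linear_iff banach_over_def
  by (auto simp: bounded_linear.linear linear_add)

text \<open>
  Otherwise Riesz' lemma provides unit vectors \<open>u n\<close> with \<open>T (u n)\<close> tending to 0 that stay at
  distance \<open>1/2\<close> from the kernel; by properness some subsequence converges, necessarily to an element
  of the kernel.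
\<close>

lemma proper_distance_to_kernel:
  fixes T :: "'a::banach \<Rightarrow> 'b::banach"
  assumes T: "bounded_linear T" and proper: "proper_on UNIV T"
  shows "\<exists>C. \<forall>x. \<exists>v. T v = 0 \<and> norm (x - v) \<le> C * norm (T x)"
proof (rule ccontr)
  interpret T: bounded_linear T by fact
  assume "\<not> ?thesis"
  then have "\<forall>n::nat. \<exists>x. \<forall>v. T v = 0 \<longrightarrow> real (Suc n) * norm (T x) < norm (x - v)"
    by (metis not_le)
  then obtain x where x: "\<And>n v. T v = 0 \<Longrightarrow> real (Suc n) * norm (T (x n)) < norm (x n - v)"
    by metis
  define V where "V = {v. T v = 0}"
  have V: "closed V" "subspace V"
    unfolding V_def
    by (auto intro!: closed_Collect_eq T.continuous_on continuous_on_id continuous_on_const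
        simp: subspace_def T.zero T.add T.scaleR)
  have "x n \<notin> V" for n
    using x[of "x n" n] by (auto simp: V_def)
  from riesz_vector[OF V this]
  have "\<exists>v. T v = 0 \<and> x n \<noteq> v \<and>
     (\<forall>w. T w = 0 \<longrightarrow> 1/2 \<le> norm ((x n - v) /\<^sub>R norm (x n - v) - w))" for n
    unfolding V_def by blast
  then obtain v where v: "\<And>n. T (v n) = 0" "\<And>n. x n \<noteq> v n"
    "\<And>n w. T w = 0 \<Longrightarrow> 1/2 \<le> norm ((x n - v n) /\<^sub>R norm (x n - v n) - w)"
    by metis
  define u where "u n = (x n - v n) /\<^sub>R norm (x n - v n)" for n
  have nu: "norm (u n) = 1" for n using v(2) by (simp add: u_def)
  have Tu: "norm (T (u n)) \<le> inverse (real (Suc n))" for n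
    using x[OF v(1), of n n] v(2)[of n]
    by (simp add: u_def T.scaleR T.diff v field_simps)
  have "(\<lambda>n. T (u n)) \<longlonglongrightarrow> 0"
    by (rule Lim_null_comparison[OF always_eventually[OF allI[OF Tu]] LIMSEQ_inverse_real_of_nat])
  then have "convergent (\<lambda>n. T (u n))" unfolding convergent_def by blast
  moreover have "bounded (range u)" using nu unfolding bounded_iff by (metis order_refl rangeE)
  ultimately obtain r l where r: "strict_mono r" "(\<lambda>n. u (r n)) \<longlonglongrightarrow> l"
    using proper_onD[OF proper, of u] by blast
  have "(\<lambda>n. T (u (r n))) \<longlonglongrightarrow> 0"
    using LIMSEQ_subseq_LIMSEQ[OF \<open>(\<lambda>n. T (u n)) \<longlonglongrightarrow> 0\<close> r(1)] by (simp add: o_def)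
  then have "T l = 0" using T.tendsto[OF r(2)] LIMSEQ_unique by blast
  then have "1/2 \<le> norm (u (r n) - l)" for n using v(3) unfolding u_def by blast
  moreover have "(\<lambda>n. norm (u (r n) - l)) \<longlonglongrightarrow> 0"
    using r(2) by (simp add: LIM_zero_iff tendsto_norm_zero)
  ultimately show False
    using LIMSEQ_le_const[of _ 0 "1/2"] by (metis half_gt_zero_iff not_le zero_less_one)
qed

text \<open>
  If the range is closed, bounded preimages turn convergence of \<open>T (x n)\<close> into
  convergence of \<open>x n\<close> modulo the kernel, whose bounded sets are relatively compact. Conversely,
  properness on the kernel is compactness, hence finite dimension; and a convergent sequence in the
  range has preimages that are bounded, by the distance estimate, so that a limit of a subsequence of
  them is a preimage of the limit.
\<close>

lemma Phi_plus_iff_proper: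
  fixes sX :: "'k::{real_normed_field,euclidean_space} \<Rightarrow> 'a::banach \<Rightarrow> 'a"
    and sY :: "'k \<Rightarrow> 'b::banach \<Rightarrow> 'b"
  assumes X: "banach_over sX" and T: "T \<in> bounded_ops sX sY"
  shows "T \<in> Phi_plus sX sY \<longleftrightarrow> proper_on UNIV T"
proof -
  interpret banach_over sX by fact
  interpret T: bounded_linear T using bounded_opsD[OF T] by blast
  interpret lin: Vector_Spaces.linear sX sY T using bounded_opsD[OF T] by blast
  define V where "V = {v. T v = 0}"
  have V: "closed_subspace sX V"
    unfolding V_def closed_subspace_def
    by (auto intro!: closed_Collect_eq T.continuous_on continuous_on_id continuous_on_const
        simp: subspace_def T.zero T.add lin.scale)
  show ?thesis
  proof
    assume "T \<in> Phi_plus sX sY"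
    then have cl: "closed (range T)" and fin: "finite_dim sX V"
      by (auto simp: Phi_plus_def V_def)
    obtain C where C: "C > 0" "\<And>y. y \<in> range T \<Longrightarrow> \<exists>x. T x = y \<and> norm x \<le> C * norm y"
      using bounded_preimages[OF T.bounded_linear_axioms cl] by blast
    show "proper_on UNIV T"
      unfolding proper_on_def
    proof (intro allI impI)
      fix x :: "nat \<Rightarrow> 'a"
      assume x: "range x \<subseteq> UNIV \<and> bounded (range x) \<and> convergent (\<lambda>n. T (x n))"
      then obtain y where y: "(\<lambda>n. T (x n)) \<longlonglongrightarrow> y" unfolding convergent_def by blast
      have "y \<in> range T" using closed_sequentially[OF cl _ y] by blast
      then obtain u where u: "y = T u" by blast
      \<comment> \<open>\<open>v n\<close> is a small vector with \<open>x n - u - v n\<close> in the kernel\<close>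
      have "\<exists>v. T v = T (x n - u) \<and> norm v \<le> C * norm (T (x n - u))" for n
        using C(2) by blast
      then obtain v where v: "\<And>n. T (v n) = T (x n - u)" "\<And>n. norm (v n) \<le> C * norm (T (x n - u))"
        by metis
      have "(\<lambda>n. T (x n - u)) \<longlonglongrightarrow> 0"
        using y by (simp add: T.diff u LIM_zero)
      then have "(\<lambda>n. C * norm (T (x n - u))) \<longlonglongrightarrow> 0"
        by (intro tendsto_mult_right_zero tendsto_norm_zero)
      then have v0: "v \<longlonglongrightarrow> 0" by (rule Lim_null_comparison[rotated]) (simp add: v)
      define w where "w n = x n - u - v n" for n
      have "bounded (range w)"
        unfolding w_def using x convergent_imp_bounded[OF v0]
        by (intro bounded_minus_comp) auto
      moreover have "range w \<subseteq> V" using v by (auto simp: w_def V_def T.diff)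
      ultimately obtain r where r: "strict_mono r" "convergent (\<lambda>n. w (r n))"
        using fin finite_dim_iff_compact[OF V] by blast
      then obtain l where l: "(\<lambda>n. w (r n)) \<longlonglongrightarrow> l" unfolding convergent_def by blast
      have "(\<lambda>n. v (r n)) \<longlonglongrightarrow> 0"
        using LIMSEQ_subseq_LIMSEQ[OF v0 r(1)] by (simp add: o_def)
      from tendsto_add[OF tendsto_add[OF l this] tendsto_const[of u]]
      have "(\<lambda>n. x (r n)) \<longlonglongrightarrow> l + 0 + u" by (simp add: w_def)
      then show "\<exists>r. strict_mono r \<and> convergent (\<lambda>n. x (r n))"
        using r(1) unfolding convergent_def by blast
    qed
  next
    assume proper: "proper_on UNIV T"
    have "finite_dim sX V"
    proof -
      have "\<exists>r. strict_mono r \<and> convergent (\<lambda>n. x (r n))"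
        if "range x \<subseteq> V" "bounded (range x)" for x :: "nat \<Rightarrow> 'a"
      proof -
        have "(\<lambda>n. T (x n)) = (\<lambda>n. 0)" using that unfolding V_def by blast
        then show ?thesis
          using proper that unfolding proper_on_def by (metis convergent_const subset_UNIV)
      qed
      then show ?thesis using finite_dim_iff_compact[OF V] by blast
    qed
    moreover have "closed (range T)"
      unfolding closed_sequential_limits
    proof (intro allI impI)
      fix y l assume y: "(\<forall>n. y n \<in> range T) \<and> y \<longlonglongrightarrow> l"
      then have "\<forall>n. \<exists>u. y n = T u" by blast
      then obtain x where x: "\<And>n. y n = T (x n)" by metis
      obtain C where C: "\<And>x. \<exists>v. T v = 0 \<and> norm (x - v) \<le> C * norm (T x)"
        using proper_distance_to_kernel[OF T.bounded_linear_axioms proper] by blast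
      have "\<forall>n. \<exists>v. T v = 0 \<and> norm (x n - v) \<le> C * norm (y n)" using C x by simp
      then obtain v where v: "\<And>n. T (v n) = 0" "\<And>n. norm (x n - v n) \<le> C * norm (y n)"
        by metis
      have "bounded (range y)" using y by (intro convergent_imp_bounded) auto
      then obtain b where b: "\<And>n. norm (y n) \<le> b" unfolding bounded_iff by blast
      have "norm (x n - v n) \<le> \<bar>C\<bar> * b" for n
        using v(2)[of n] b[of n] by (meson abs_ge_self abs_ge_zero mult_mono norm_ge_zero order_trans)
      then have "bounded (range (\<lambda>n. x n - v n))" unfolding bounded_iff by blast
      moreover have yT: "T (x n - v n) = y n" for n by (simp add: T.diff v x)
      moreover have "convergent (\<lambda>n. T (x n - v n))"
        unfolding yT convergent_def using y by blast
      ultimately obtain r m where r: "strict_mono r" "(\<lambda>n. x (r n) - v (r n)) \<longlonglongrightarrow> m"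
        using proper_onD[OF proper, of "\<lambda>n. x n - v n"] by blast
      have "(\<lambda>n. y (r n)) \<longlonglongrightarrow> T m" using T.tendsto[OF r(2)] by (simp add: yT)
      moreover have "(\<lambda>n. y (r n)) \<longlonglongrightarrow> l"
        using LIMSEQ_subseq_LIMSEQ[of y l r] y r by (simp add: o_def)
      ultimately show "l \<in> range T" using LIMSEQ_unique by blast
    qed
    ultimately show "T \<in> Phi_plus sX sY" using T by (simp add: Phi_plus_def V_def)
  qed
qed

lemma bounded_below_imp_proper_on:
  fixes T :: "'a::banach \<Rightarrow> 'b::banach"
  assumes T: "bounded_linear T" and W: "subspace W" and c: "c > 0"
    and below: "\<And>x. x \<in> W \<Longrightarrow> c * norm x \<le> norm (T x)"
  shows "proper_on W T"
  unfolding proper_on_def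
proof (intro allI impI)
  interpret T: bounded_linear T by fact
  fix x :: "nat \<Rightarrow> 'a"
  assume x: "range x \<subseteq> W \<and> bounded (range x) \<and> convergent (\<lambda>n. T (x n))"
  then have Cau: "Cauchy (\<lambda>n. T (x n))" using convergent_Cauchy by blast
  have le: "c * norm (x m - x n) \<le> norm (T (x m) - T (x n))" for m n
    using below[of "x m - x n"] x W by (auto simp: T.diff image_subset_iff subspace_diff)
  have "Cauchy x"
  proof (rule CauchyI)
    fix e :: real assume "e > 0"
    then obtain N where N: "\<And>m n. m \<ge> N \<Longrightarrow> n \<ge> N \<Longrightarrow> norm (T (x m) - T (x n)) < c * e"
      using CauchyD[OF Cau, of "c * e"] c by auto
    have "norm (x m - x n) < e" if "m \<ge> N" "n \<ge> N" for m n
      using le_less_trans[OF le N[OF that]] c by simp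
    then show "\<exists>N. \<forall>m\<ge>N. \<forall>n\<ge>N. norm (x m - x n) < e" by blast
  qed
  then show "\<exists>r. strict_mono r \<and> convergent (\<lambda>n. x (r n))"
    by (intro exI[of _ id]) (simp add: strict_mono_id Cauchy_convergent)
qed

text \<open>
  Passing to a hyperplane of \<open>W\<close> loses only one coordinate, and a bounded sequence of real
  coordinates has a convergent subsequence.
\<close>

lemma proper_on_insert_functional:
  fixes T :: "'a::banach \<Rightarrow> 'b::banach" and f :: "'a \<Rightarrow> real"
  assumes T: "bounded_linear T" and W: "subspace W" and f: "bounded_linear f"
    and proper: "proper_on {x\<in>W. f x = 0} T"
  shows "proper_on W T"
proof (cases "\<forall>x\<in>W. f x = 0")
  case True
  then have "{x\<in>W. f x = 0} = W" by blast
  then show ?thesis using proper by simp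
next
  interpret T: bounded_linear T by fact
  interpret f: bounded_linear f by fact
  case False
  then obtain w where w: "w \<in> W" "f w \<noteq> 0" by blast
  define u where "u = w /\<^sub>R f w"
  have u: "u \<in> W" "f u = 1" using w W by (auto simp: u_def subspace_scale f.scaleR)
  show ?thesis
    unfolding proper_on_def
  proof (intro allI impI)
    fix x :: "nat \<Rightarrow> 'a"
    assume x: "range x \<subseteq> W \<and> bounded (range x) \<and> convergent (\<lambda>n. T (x n))"
    then obtain t where t: "(\<lambda>n. T (x n)) \<longlonglongrightarrow> t" unfolding convergent_def by blast
    have "bounded (range (\<lambda>n. f (x n)))"
      using bounded_linear_image[OF _ f, of "range x"] x by (simp add: image_image)
    then obtain r1 a where r1: "strict_mono r1" "((\<lambda>n. f (x n)) \<circ> r1) \<longlonglongrightarrow> a"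
      using bounded_imp_convergent_subsequence by metis
    have fa: "(\<lambda>n. f (x (r1 n)) *\<^sub>R u) \<longlonglongrightarrow> a *\<^sub>R u"
      using tendsto_scaleR[OF r1(2) tendsto_const[of u]] by (simp add: o_def)
    define y where "y n = x (r1 n) - f (x (r1 n)) *\<^sub>R u" for n
    have "bounded (range (\<lambda>n. x (r1 n)))"
      using x by (auto intro: bounded_subset)
    then have "bounded (range y)"
      unfolding y_def using convergent_imp_bounded[OF fa] by (rule bounded_minus_comp)
    moreover have "y n \<in> {x\<in>W. f x = 0}" for n
    proof -
      have "x (r1 n) \<in> W" using x by blast
      then show ?thesis
        using u W by (simp add: y_def f.diff f.scaleR subspace_diff subspace_scale)
    qed
    moreover have "(\<lambda>n. T (y n)) \<longlonglongrightarrow> t - T (a *\<^sub>R u)"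
      unfolding y_def T.diff
      using LIMSEQ_subseq_LIMSEQ[OF t r1(1)] T.tendsto[OF fa]
      by (intro tendsto_diff) (auto simp: o_def)
    ultimately obtain r2 l where r2: "strict_mono r2" "(\<lambda>n. y (r2 n)) \<longlonglongrightarrow> l"
      using proper_onD[OF proper, of y] unfolding convergent_def by blast
    have "(\<lambda>n. f (x (r1 (r2 n))) *\<^sub>R u) \<longlonglongrightarrow> a *\<^sub>R u"
      using LIMSEQ_subseq_LIMSEQ[OF fa r2(1)] by (simp add: o_def)
    from tendsto_add[OF r2(2) this] have "(\<lambda>n. x ((r1 \<circ> r2) n)) \<longlonglongrightarrow> l + a *\<^sub>R u"
      by (simp add: y_def)
    then show "\<exists>r. strict_mono r \<and> convergent (\<lambda>n. x (r n))"
      using strict_mono_o[OF r1(1) r2(1)] unfolding convergent_def by blast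
  qed
qed

lemma subspace_common_kernel:
  assumes "\<And>f. f \<in> G \<Longrightarrow> bounded_linear (f :: 'a::real_normed_vector \<Rightarrow> real)"
  shows "subspace {x. \<forall>f\<in>G. f x = 0}"
  using assms bounded_linear.linear by (fastforce simp: subspace_def linear_0 linear_add linear_scale)

lemma proper_on_common_kernel:
  fixes T :: "'a::banach \<Rightarrow> 'b::banach"
  assumes T: "bounded_linear T" and "finite G"
    and "\<And>f. f \<in> G \<Longrightarrow> bounded_linear (f :: 'a \<Rightarrow> real)"
    and "proper_on {x. \<forall>f\<in>G. f x = 0} T"
  shows "proper_on UNIV T"
  using assms(2-)
proof (induction G rule: finite_induct)
  case empty
  then show ?case by simp
next
  case (insert f G)
  have G: "bounded_linear g" if "g \<in> G" for g using insert.prems(1) that by blast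
  have "subspace {x. \<forall>f\<in>G. f x = 0}"
    using G by (rule subspace_common_kernel)
  moreover have "{x. \<forall>g\<in>insert f G. g x = 0} = {x \<in> {x. \<forall>g\<in>G. g x = 0}. f x = 0}" by blast
  ultimately have "proper_on {x. \<forall>g\<in>G. g x = 0} T"
    using insert.prems proper_on_insert_functional[OF T] by fastforce
  then show ?case using insert.IH G by blast
qed

section \<open>Triangular systems and subspaces on which an operator is small\<close>

context banach_over
begin

text \<open>
  The functionals are only real linear. For their kernels to contain all scalar multiples of
  \<open>x\<close>, a test on the finitely many basis elements of the scalar field suffices; this keeps the
  families of functionals finite.
\<close>

lemma scaled_functional_zero:
  assumes f: "bounded_linear (f :: 'a \<Rightarrow> real)" and "\<And>j. j \<in> Basis \<Longrightarrow> f (s j x) = 0"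
  shows "f (s a x) = 0"
proof -
  interpret f: bounded_linear f by fact
  interpret sx: bounded_linear "\<lambda>k. s k x" by (rule bounded_linear_scale_left)
  have "s a x = (\<Sum>j\<in>Basis. (a \<bullet> j) *\<^sub>R s j x)"
    by (subst euclidean_representation[of a, symmetric]) (simp only: sx.sum sx.scaleR)
  then have "f (s a x) = (\<Sum>j\<in>Basis. (a \<bullet> j) *\<^sub>R f (s j x))"
    by (simp add: f.sum f.scaleR)
  then show ?thesis using assms(2) by simp
qed

text \<open>
  Were there no such vector, the operator would be bounded below on a subspace of finite
  codimension, hence proper there, hence proper everywhere.
\<close>

lemma not_proper_small_vector:
  fixes T :: "'a \<Rightarrow> 'b::banach"
  assumes T: "bounded_linear T" and "\<not> proper_on UNIV T"
    and G: "finite G" "\<And>f. f \<in> G \<Longrightarrow> bounded_linear (f :: 'a \<Rightarrow> real)" and e: "e > 0"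
  shows "\<exists>x. norm x = 1 \<and> (\<forall>f\<in>G. \<forall>a. f (s a x) = 0) \<and> norm (T x) \<le> e"
proof (rule ccontr)
  interpret T: bounded_linear T by fact
  assume none: "\<not> ?thesis"
  define H where "H = (\<lambda>(f, j). \<lambda>x. f (s j x)) ` (G \<times> (Basis :: 'k set))"
  have H: "finite H" "\<And>h. h \<in> H \<Longrightarrow> bounded_linear h"
    using G bounded_linear_compose[OF _ bounded_linear_scale] by (auto simp: H_def)
  define W where "W = {x. \<forall>h\<in>H. h x = 0}"
  have sub: "Real_Vector_Spaces.subspace W"
    unfolding W_def using H(2) by (rule subspace_common_kernel)
  have "e * norm x \<le> norm (T x)" if x: "x \<in> W" for x
  proof (cases "x = 0")
    case False
    define u where "u = x /\<^sub>R norm x"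
    have u: "u \<in> W" "norm u = 1"
      using x sub False by (auto simp: u_def real_vector.subspace_scale)
    have "f (s a u) = 0" if f: "f \<in> G" for f a
    proof (rule scaled_functional_zero[OF G(2)[OF f]])
      fix j :: 'k assume "j \<in> Basis"
      then have h: "(\<lambda>x. f (s j x)) \<in> H"
        unfolding H_def using f by (intro image_eqI[of _ _ "(f, j)"]) auto
      have "\<forall>h\<in>H. h u = 0" using u(1) by (simp add: W_def)
      from bspec[OF this h] show "f (s j u) = 0" .
    qed
    then have "e < norm (T u)" using none u(2) by (metis not_le)
    then show ?thesis using False by (simp add: u_def T.scaleR field_simps)
  qed simp
  then have "proper_on W T"
    using bounded_below_imp_proper_on[OF T sub e] by blast
  then show False
    using assms(2) proper_on_common_kernel[OF T H] unfolding W_def by blast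
qed

text \<open>
  Each new vector is chosen in the kernels of the norming functionals of all previous ones. The
  functional \<open>f m\<close> therefore ignores every multiple of the later vectors, and this allows the coordinates
  of a combination of the \<open>x n\<close> to be read off from the first one on.
\<close>

lemma triangular_system:
  fixes T :: "'a \<Rightarrow> 'b::banach"
  assumes small: "\<And>(H :: ('a \<Rightarrow> real) set) e. finite H \<Longrightarrow> (\<forall>f\<in>H. bounded_linear f) \<Longrightarrow> e > 0 \<Longrightarrow>
      \<exists>x. norm x = 1 \<and> (\<forall>f\<in>H. \<forall>a. f (s a x) = 0) \<and> norm (T x) \<le> e"
    and G: "finite G" "\<And>f. f \<in> G \<Longrightarrow> bounded_linear (f :: 'a \<Rightarrow> real)"
    and eps: "\<And>n::nat. eps n > 0"
  obtains x f where
    "\<And>n. norm (x n) = 1" "\<And>n. norm (T (x n)) \<le> eps n"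
    "\<And>n a g. g \<in> G \<Longrightarrow> g (s a (x n)) = 0"
    "\<And>n. bounded_linear (f n :: 'a \<Rightarrow> real)" "\<And>n. f n (x n) = 1" "\<And>n y. \<bar>f n y\<bar> \<le> norm y"
    "\<And>m n a. m < n \<Longrightarrow> f m (s a (x n)) = 0"
proof -
  define P where "P h n p \<longleftrightarrow> norm (fst p) = 1 \<and> norm (T (fst p)) \<le> eps n \<and>
      (\<forall>g\<in>G. \<forall>a. g (s a (fst p)) = 0) \<and> bounded_linear (snd p) \<and> snd p (fst p) = 1 \<and>
      (\<forall>y. \<bar>snd p y\<bar> \<le> norm y) \<and> (\<forall>m<n. \<forall>a. snd (h m) (s a (fst p)) = 0)"
    for h :: "nat \<Rightarrow> 'a \<times> ('a \<Rightarrow> real)" and n p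
  have "\<exists>h. \<forall>n. P h n (h n)"
  proof (rule dependent_wellorder_choice[of P])
    fix r and h h' :: "nat \<Rightarrow> 'a \<times> ('a \<Rightarrow> real)" and n
    assume "\<And>i. i < n \<Longrightarrow> h i = h' i"
    then show "P h n r = P h' n r" unfolding P_def by simp
  next
    fix n and h :: "nat \<Rightarrow> 'a \<times> ('a \<Rightarrow> real)"
    assume h: "\<And>i. i < n \<Longrightarrow> P h i (h i)"
    define H where "H = G \<union> (\<lambda>m. snd (h m)) ` {..<n}"
    have "finite H" "\<forall>f\<in>H. bounded_linear f"
      using G h unfolding H_def P_def by auto
    from small[OF this eps[of n]]
    obtain x where x: "norm x = 1" "\<And>f a. f \<in> H \<Longrightarrow> f (s a x) = 0" "norm (T x) \<le> eps n"
      by blast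
    obtain f where f: "bounded_linear f" "f x = norm x" "\<And>y. \<bar>f y\<bar> \<le> norm y"
      using norming_functional[of x] by blast
    have "P h n (x, f)" unfolding P_def using x f by (auto simp: H_def)
    then show "\<exists>p. P h n p" by blast
  qed
  then obtain h where h: "\<And>n. P h n (h n)" by blast
  show thesis
    by (rule that[of "\<lambda>n. fst (h n)" "\<lambda>n. snd (h n)"]) (use h in \<open>auto simp: P_def\<close>)
qed

lemma triangular_separated:
  assumes "\<And>n. bounded_linear (f n :: 'a \<Rightarrow> real)" "\<And>n. f n (x n) = 1" "\<And>n y. \<bar>f n y\<bar> \<le> norm y"
    and tri: "\<And>m n a. m < n \<Longrightarrow> f m (s a (x n)) = 0" and "m < (n::nat)"
  shows "1 \<le> norm (x n - x m)"
proof -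
  interpret f: bounded_linear "f m" by fact
  have "f m (x n - x m) = - 1" using tri[OF \<open>m < n\<close>, of 1] assms(2) by (simp add: f.diff)
  then show ?thesis using assms(3)[of m "x n - x m"] by simp
qed

text \<open>
  Otherwise a triangular system with \<open>T (x n)\<close> tending to 0 exists, and a triangular system
  has no convergent subsequence.
\<close>

lemma proper_bounded_below_on_kernels:
  fixes T :: "'a \<Rightarrow> 'b::banach"
  assumes T: "bounded_linear T" and proper: "proper_on UNIV T"
  shows "\<exists>(G :: ('a \<Rightarrow> real) set) c. finite G \<and> (\<forall>f\<in>G. bounded_linear f) \<and> c > 0 \<and>
    (\<forall>x. (\<forall>f\<in>G. \<forall>a. f (s a x) = 0) \<longrightarrow> c * norm x \<le> norm (T x))"
proof (rule ccontr)
  interpret T: bounded_linear T by fact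
  assume none: "\<not> ?thesis"
  have bad: "\<exists>x. (\<forall>f\<in>G. \<forall>a. f (s a x) = 0) \<and> norm (T x) < c * norm x"
    if "finite G" "\<forall>f\<in>G. bounded_linear f" "c > 0" for G :: "('a \<Rightarrow> real) set" and c
    using none that by (meson not_le)
  have "\<exists>x. norm x = 1 \<and> (\<forall>f\<in>H. \<forall>a. f (s a x) = 0) \<and> norm (T x) \<le> e"
    if H: "finite H" "\<forall>f\<in>H. bounded_linear f" "e > 0" for H :: "('a \<Rightarrow> real) set" and e
  proof -
    obtain x where x: "\<forall>f\<in>H. \<forall>a. f (s a x) = 0" "norm (T x) < e * norm x"
      using bad[OF H] by blast
    have "x \<noteq> 0" using x(2) by (auto simp: T.zero)
    then have "norm (x /\<^sub>R norm x) = 1" "norm (T (x /\<^sub>R norm x)) \<le> e"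
      using x(2) by (auto simp: T.scaleR field_simps)
    moreover have "f (s a (x /\<^sub>R norm x)) = 0" if "f \<in> H" for f a
      using x(1) H(2) that bounded_linear.linear[of f] by (simp add: scale_scaleR linear_scale)
    ultimately show ?thesis by blast
  qed
  from triangular_system[OF this, of "{}" "\<lambda>n. inverse (real (Suc n))"]
  obtain x and f :: "nat \<Rightarrow> 'a \<Rightarrow> real" where x: "\<And>n. norm (x n) = 1"
    "\<And>n. norm (T (x n)) \<le> inverse (real (Suc n))"
    and f: "\<And>n. bounded_linear (f n)" "\<And>n. f n (x n) = 1" "\<And>n y. \<bar>f n y\<bar> \<le> norm y"
    "\<And>m n a. m < n \<Longrightarrow> f m (s a (x n)) = 0"
    by auto
  have "(\<lambda>n. T (x n)) \<longlonglongrightarrow> 0"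
    by (rule Lim_null_comparison[OF always_eventually[OF allI[OF x(2)]] LIMSEQ_inverse_real_of_nat])
  then have "convergent (\<lambda>n. T (x n))" unfolding convergent_def by blast
  moreover have "bounded (range x)" using x(1) unfolding bounded_iff by (metis order_refl rangeE)
  ultimately obtain r l where r: "strict_mono r" "(\<lambda>n. x (r n)) \<longlonglongrightarrow> l"
    using proper_onD[OF proper, of x] by blast
  then show False
    using separated_no_convergent_subseq[of 1 x r] triangular_separated[OF f]
    unfolding convergent_def by fastforce
qed

lemma span_sequence_coefficients:
  assumes "m \<in> span (range x)"
  obtains a N where "m = (\<Sum>i<N. s (a i) (x (i::nat)))"
proof -
  have fin: "\<exists>a. v = (\<Sum>i<N. s (a i) (x i))" if "v \<in> span (x ` {..<N})" for v N
    using that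
  proof (induction N arbitrary: v)
    case 0
    then show ?case by simp
  next
    case (Suc N)
    then obtain k where "v - s k (x N) \<in> span (x ` {..<N})"
      by (auto simp: lessThan_Suc span_breakdown_eq)
    then obtain a where a: "v - s k (x N) = (\<Sum>i<N. s (a i) (x i))" using Suc.IH by blast
    have "v = (\<Sum>i<Suc N. s ((a(N := k)) i) (x i))"
      using a by (simp add: algebra_simps)
    then show ?case by blast
  qed
  obtain t where t: "finite t" "t \<subseteq> range x" "m \<in> span t"
    using assms unfolding span_explicit by (auto intro: span_sum span_scale span_base)
  obtain I where I: "finite I" "t = x ` I" using finite_subset_image[OF t(1,2)] by blast
  obtain N where "I \<subseteq> {..<N}" using I(1) finite_nat_bounded by blast
  then have "m \<in> span (x ` {..<N})" using t(3) I(2) span_mono[of t "x ` {..<N}"] by blast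
  then show thesis using fin that by blast
qed

text \<open>
  After division by \<open>a n\<close>, the part of \<open>m\<close> from index \<open>n\<close> on has \<open>f n\<close>-value 1, so its norm is at
  least \<open>norm (a n)\<close>. It differs from \<open>m\<close> by the first \<open>n\<close> terms, which the
  induction hypothesis bounds by \<open>(2 ^ n - 1) * norm m\<close>. The division avoids the question whether \<open>f n\<close>
  is linear over the full scalar field.
\<close>

lemma triangular_coefficient_bound:
  assumes x: "\<And>n. norm (x n) = 1"
    and f: "\<And>n. bounded_linear (f n :: 'a \<Rightarrow> real)" "\<And>n. f n (x n) = 1" "\<And>n y. \<bar>f n y\<bar> \<le> norm y"
      "\<And>m n a. m < n \<Longrightarrow> f m (s a (x n)) = 0"
    and m: "m = (\<Sum>i<N. s (a i) (x i))" and "n < N"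
  shows "norm (a n) \<le> 2 ^ n * norm m"
  using \<open>n < N\<close>
proof (induction n rule: less_induct)
  case (less n)
  interpret f: bounded_linear "f n" by (rule f)
  define tail where "tail = (\<Sum>i\<in>{Suc n..<N}. s (a i) (x i))"
  have split: "m - (\<Sum>i<n. s (a i) (x i)) = s (a n) (x n) + tail"
  proof -
    have "{..<N} = {..<n} \<union> {n..<N}" using less.prems by auto
    then have "m = (\<Sum>i<n. s (a i) (x i)) + (\<Sum>i\<in>{n..<N}. s (a i) (x i))"
      unfolding m by (simp add: sum.union_disjoint ivl_disj_int)
    then show ?thesis
      using less.prems by (simp add: tail_def sum.atLeast_Suc_lessThan)
  qed
  have "norm (a n) \<le> norm (s (a n) (x n) + tail)"
  proof (cases "a n = 0")
    case False
    let ?r = "s (inverse (a n)) (s (a n) (x n) + tail)"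
    have "?r = x n + (\<Sum>i\<in>{Suc n..<N}. s (inverse (a n) * a i) (x i))"
      using False by (simp add: tail_def scale_right_distrib scale_sum_right)
    then have "f n ?r = 1"
      using f by (simp add: f.add f.sum)
    then have "1 \<le> norm ?r" using f(3)[of n ?r] by simp
    also have "norm ?r = norm (s (a n) (x n) + tail) / norm (a n)"
      by (simp only: norm_scale norm_inverse divide_inverse mult.commute)
    finally show ?thesis using False by (simp add: field_simps)
  qed simp
  also have "\<dots> \<le> norm m + (\<Sum>i<n. norm (s (a i) (x i)))"
    unfolding split[symmetric] by (rule order_trans[OF norm_triangle_ineq4 add_left_mono[OF norm_sum]])
  also have "\<dots> \<le> norm m + (\<Sum>i<n. 2 ^ i * norm m)"
    using less by (intro add_left_mono sum_mono) (simp add: norm_scale x)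
  also have "\<dots> = 2 ^ n * norm m"
  proof -
    have "(\<Sum>i<n. 2 ^ i) = (2 ^ n - 1 :: real)" by (induction n) auto
    then have "norm m * (1 + (\<Sum>i<n. 2 ^ i)) = norm m * 2 ^ n" by simp
    then show ?thesis by (simp add: algebra_simps sum_distrib_left)
  qed
  finally show ?case .
qed

lemma closed_subspace_closure:
  assumes V: "subspace V" shows "closed_subspace s (closure V)"
proof -
  have "0 \<in> closure V" using subspace_0[OF V] closure_subset by auto
  moreover have "u + v \<in> closure V" if uv: "u \<in> closure V" "v \<in> closure V" for u v
  proof -
    obtain x y where "\<forall>n. x n \<in> V" "x \<longlonglongrightarrow> u" "\<forall>n. y n \<in> V" "y \<longlonglongrightarrow> v"
      using uv unfolding closure_sequential by blast
    then have "(\<forall>n. x n + y n \<in> V) \<and> (\<lambda>n. x n + y n) \<longlonglongrightarrow> u + v"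
      using V by (simp add: subspace_add tendsto_add)
    then show ?thesis
      unfolding closure_sequential by (rule exI[of _ "\<lambda>n. x n + y n"])
  qed
  moreover have "s k v \<in> closure V" if v: "v \<in> closure V" for k v
  proof -
    obtain y where "\<forall>n. y n \<in> V" "y \<longlonglongrightarrow> v"
      using v unfolding closure_sequential by blast
    then have "(\<forall>n. s k (y n) \<in> V) \<and> (\<lambda>n. s k (y n)) \<longlonglongrightarrow> s k v"
      using V by (simp add: subspace_scale bounded_linear.tendsto[OF bounded_linear_scale])
    then show ?thesis
      unfolding closure_sequential by (rule exI[of _ "\<lambda>n. s k (y n)"])
  qed
  ultimately show ?thesis by (simp add: closed_subspace_def subspace_def)
qed

text \<open>
  The closed span of a triangular system. Coefficients grow at most like \<open>2 ^ n\<close>, so values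
  \<open>T (x n)\<close> of size \<open>e / (2 * 4 ^ n)\<close> contribute at most \<open>e * norm m\<close> altogether.
\<close>

lemma not_proper_small_subspace:
  fixes T :: "'a \<Rightarrow> 'b::banach"
  assumes Y: "banach_over sY" and T: "T \<in> bounded_ops s sY" and np: "\<not> proper_on UNIV T"
    and G: "finite G" "\<And>f. f \<in> G \<Longrightarrow> bounded_linear (f :: 'a \<Rightarrow> real)" and e: "e > 0"
  obtains M where "closed_subspace s M" "\<not> finite_dim s M"
    "\<And>m g. m \<in> M \<Longrightarrow> g \<in> G \<Longrightarrow> g m = 0" "\<And>m. m \<in> M \<Longrightarrow> norm (T m) \<le> e * norm m"
proof -
  interpret T: bounded_linear T using bounded_opsD[OF T] by blast
  have small: "\<exists>x. norm x = 1 \<and> (\<forall>f\<in>H. \<forall>a. f (s a x) = 0) \<and> norm (T x) \<le> d"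
    if "finite H" "\<forall>f\<in>H. bounded_linear f" "d > 0" for H :: "('a \<Rightarrow> real) set" and d
    by (rule not_proper_small_vector[OF T.bounded_linear_axioms np]) (use that in auto)
  obtain x f where x: "\<And>n. norm (x n) = 1" "\<And>n. norm (T (x n)) \<le> e / (2 * 4 ^ n)"
      "\<And>n a g. g \<in> G \<Longrightarrow> g (s a (x n)) = 0"
    and f: "\<And>n. bounded_linear (f n :: 'a \<Rightarrow> real)" "\<And>n. f n (x n) = 1" "\<And>n y. \<bar>f n y\<bar> \<le> norm y"
      "\<And>m n a. m < n \<Longrightarrow> f m (s a (x n)) = 0"
    using triangular_system[OF small G, of "\<lambda>n. e / (2 * 4 ^ n)"] e by auto
  have normT: "norm (T (s a v)) = norm a * norm (T v)" for a v
    using bounded_opsD(3)[OF T] banach_over.norm_scale[OF Y] by simp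
  have T0: "norm (T m) \<le> e * norm m" and G0: "g \<in> G \<Longrightarrow> g m = 0"
    if "m \<in> span (range x)" for m g
  proof -
    obtain a N where m: "m = (\<Sum>i<N. s (a i) (x i))"
      using span_sequence_coefficients \<open>m \<in> span (range x)\<close> by blast
    have "norm (T m) \<le> (\<Sum>i<N. norm (T (s (a i) (x i))))"
      unfolding m T.sum by (rule norm_sum)
    also have "\<dots> \<le> (\<Sum>i<N. e * norm m * (1/2) ^ Suc i)"
    proof (rule sum_mono)
      fix i assume i: "i \<in> {..<N}"
      have "norm (T (s (a i) (x i))) \<le> (2 ^ i * norm m) * (e / (2 * 4 ^ i))"
        unfolding normT
        using triangular_coefficient_bound[OF x(1) f m] i x(2) by (intro mult_mono) auto
      also have "\<dots> = e * norm m * (1/2) ^ Suc i"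
      proof -
        have "(4::real) ^ i = 2 ^ i * 2 ^ i" by (simp flip: power_mult_distrib)
        then show ?thesis by (simp add: field_simps)
      qed
      finally show "norm (T (s (a i) (x i))) \<le> e * norm m * (1/2) ^ Suc i" .
    qed
    also have "\<dots> = e * norm m * (1 - (1/2) ^ N)"
    proof -
      have "(\<Sum>i<N. (1/2) ^ Suc i) = (1 - (1/2) ^ N :: real)"
        by (induction N) (auto simp: field_simps)
      then show ?thesis by (metis sum_distrib_left)
    qed
    also have "\<dots> \<le> e * norm m" using e by (simp add: mult_left_le)
    finally show "norm (T m) \<le> e * norm m" .
    show "g m = 0" if "g \<in> G"
    proof -
      interpret g: bounded_linear g using G(2) that by blast
      show ?thesis unfolding m g.sum using x(3)[OF that] by simp
    qed
  qed
  define M where "M = closure (span (range x))"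
  have M: "closed_subspace s M"
    unfolding M_def by (rule closed_subspace_closure[OF subspace_span])
  have "\<not> finite_dim s M"
  proof
    assume "finite_dim s M"
    moreover have "range x \<subseteq> M"
      unfolding M_def by (rule subset_trans[OF span_superset closure_subset])
    moreover have "bounded (range x)" using x(1) unfolding bounded_iff by (metis order_refl rangeE)
    ultimately obtain r :: "nat \<Rightarrow> nat" where "strict_mono r" "convergent (\<lambda>n. x (r n))"
      using finite_dim_iff_compact[OF M] by blast
    then show False
      using separated_no_convergent_subseq[of 1 x r] triangular_separated[OF f] by fastforce
  qed
  moreover have "g m = 0" if "m \<in> M" "g \<in> G" for m g
  proof -
    have "closed {m. g m = 0}"
      using G(2)[OF that(2)]
      by (intro closed_Collect_eq continuous_intros linear_continuous_on)
    then have "M \<subseteq> {m. g m = 0}"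
      unfolding M_def using G0 that by (intro closure_minimal) auto
    then show ?thesis using that by blast
  qed
  moreover have "norm (T m) \<le> e * norm m" if "m \<in> M" for m
  proof -
    have "closed {m. norm (T m) \<le> e * norm m}"
      by (intro closed_Collect_le continuous_intros T.continuous_on)
    then have "M \<subseteq> {m. norm (T m) \<le> e * norm m}"
      unfolding M_def using T0 by (intro closure_minimal) auto
    then show ?thesis using that by blast
  qed
  ultimately show thesis using that M by blast
qed

end

section \<open>Perturbation classes and \<open>\<Phi>\<close>-singular operators\<close>

lemma square_scale_eq:
  assumes "banach_over s" shows "square_scale s k p = (s k (fst p), s k (snd p))"
proof -
  interpret banach_over s by fact
  have "module_prod s s" by (simp add: module_prod_def module_pair_def module_axioms)
  then show ?thesis by (simp add: module_prod.scale_def)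
qed

lemma Pair_bounded_ops:
  assumes "banach_over sX" "banach_over sY" "S \<in> bounded_ops sX sY" "K \<in> bounded_ops sX sY"
  shows "(\<lambda>x. (S x, K x)) \<in> bounded_ops sX (square_scale sY)"
  using assms
  by (intro bounded_opsI banach_over_square bounded_linear_Pair)
    (auto simp: square_scale_eq bounded_opsD)

lemma Phi_plus_bounded_ops: "T \<in> Phi_plus sX sY \<Longrightarrow> T \<in> bounded_ops sX sY"
  by (simp add: Phi_plus_def)

text \<open>
  Properness passes from a composition to its right factor. With a left inverse in the role
  of \<open>A\<close> this also gives stability of the semi-Fredholm operators under isomorphic embeddings of the
  target space.
\<close>

lemma Phi_plus_right_factor:
  fixes sX :: "'k::{real_normed_field,euclidean_space} \<Rightarrow> 'a::banach \<Rightarrow> 'a"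
    and sY :: "'k \<Rightarrow> 'b::banach \<Rightarrow> 'b" and sZ :: "'k \<Rightarrow> 'c::banach \<Rightarrow> 'c"
  assumes X: "banach_over sX" and T: "T \<in> Phi_plus sX sZ" and S: "S \<in> bounded_ops sX sY"
    and A: "bounded_linear A" and AS: "\<And>x. A (S x) = T x"
  shows "S \<in> Phi_plus sX sY"
proof -
  have proper: "proper_on UNIV T"
    using Phi_plus_iff_proper[OF X Phi_plus_bounded_ops[OF T]] T by blast
  have "proper_on UNIV S"
    unfolding proper_on_def
  proof (intro allI impI)
    fix x :: "nat \<Rightarrow> 'a"
    assume x: "range x \<subseteq> UNIV \<and> bounded (range x) \<and> convergent (\<lambda>n. S (x n))"
    then obtain l where "(\<lambda>n. S (x n)) \<longlonglongrightarrow> l" unfolding convergent_def by blast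
    from bounded_linear.tendsto[OF A this] have "convergent (\<lambda>n. T (x n))"
      unfolding AS convergent_def by blast
    then show "\<exists>r. strict_mono r \<and> convergent (\<lambda>n. x (r n))"
      using proper x unfolding proper_on_def by blast
  qed
  then show ?thesis using Phi_plus_iff_proper[OF X S] by blast
qed

text \<open>
  For small \<open>t\<close> the equation \<open>z = y + t *\<^sub>R L z\<close> is a fixed point problem for a contraction.
\<close>

lemma neumann_inverse:
  fixes L :: "'b::banach \<Rightarrow> 'b"
  assumes L: "bounded_linear L"
  obtains t B where "t > 0" "bounded_linear B"
    "\<And>y. B y - t *\<^sub>R L (B y) = y" "\<And>y. B (y - t *\<^sub>R L y) = y"
proof -
  interpret L: bounded_linear L by fact
  obtain M where M: "M > 0" "\<And>y. norm (L y) \<le> norm y * M" using L.pos_bounded by blast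
  define t where "t = 1 / (2 * M)"
  have t: "t > 0" using M by (simp add: t_def)
  have half: "norm (t *\<^sub>R L y) \<le> norm y / 2" for y
  proof -
    have "t * norm (L y) \<le> t * (norm y * M)" using M(2)[of y] t by (intro mult_left_mono) auto
    also have "\<dots> = norm y / 2" using M(1) by (simp add: t_def)
    finally show ?thesis using t by simp
  qed
  have ex1: "\<exists>!z. z - t *\<^sub>R L z = y" for y
  proof -
    have "dist (y + t *\<^sub>R L u) (y + t *\<^sub>R L v) \<le> 1/2 * dist u v" for u v
      using half[of "u - v"] by (simp add: dist_norm L.diff scaleR_diff_right)
    then have "\<exists>!z. y + t *\<^sub>R L z = z"
      by (intro banach_fix_type[of "1/2"]) auto
    moreover have "y + t *\<^sub>R L z = z \<longleftrightarrow> z - t *\<^sub>R L z = y" for z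
      by (metis diff_eq_eq)
    ultimately show ?thesis by simp
  qed
  define B where "B y = (THE z. z - t *\<^sub>R L z = y)" for y
  have B1: "B y - t *\<^sub>R L (B y) = y" for y
    unfolding B_def by (rule theI'[OF ex1])
  have B2: "B (y - t *\<^sub>R L y) = y" for y
    using ex1[of "y - t *\<^sub>R L y"] B1[of "y - t *\<^sub>R L y"] by blast
  have "B (y + z) = B y + B z" for y z
  proof -
    have "(B y + B z) - t *\<^sub>R L (B y + B z) = (B y - t *\<^sub>R L (B y)) + (B z - t *\<^sub>R L (B z))"
      by (simp add: L.add algebra_simps)
    then have "(B y + B z) - t *\<^sub>R L (B y + B z) = y + z" by (simp only: B1)
    then show ?thesis using B2 by metis
  qed
  moreover have "B (r *\<^sub>R y) = r *\<^sub>R B y" for r y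
  proof -
    have "r *\<^sub>R B y - t *\<^sub>R L (r *\<^sub>R B y) = r *\<^sub>R (B y - t *\<^sub>R L (B y))"
      by (simp add: L.scaleR algebra_simps)
    then have "r *\<^sub>R B y - t *\<^sub>R L (r *\<^sub>R B y) = r *\<^sub>R y" by (simp only: B1)
    then show ?thesis using B2 by metis
  qed
  moreover have "norm (B y) \<le> norm y * 2" for y
    using half[of "B y"] norm_triangle_ineq[of y "t *\<^sub>R L (B y)"] B1[of y]
    by (simp add: diff_eq_eq)
  ultimately have "bounded_linear B" by (rule bounded_linear_intro)
  then show thesis using that t B1 B2 by blast
qed

text \<open>
  The perturbation class absorbs operators from the left. Let \<open>A = 1 - t L\<close>, which is invertible
  with inverse \<open>B\<close>. Adding \<open>K\<close> to \<open>R1 = B (t T)\<close> and applying \<open>- A\<close> gives \<open>R2 = - t T - K + t L K\<close>;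
  adding \<open>K\<close> once more leaves \<open>- t (T - L K)\<close>.
\<close>

lemma Phi_plus_diff_image_of_perturbation:
  fixes sX :: "'k::{real_normed_field,euclidean_space} \<Rightarrow> 'a::banach \<Rightarrow> 'a"
    and sY :: "'k \<Rightarrow> 'b::banach \<Rightarrow> 'b"
  assumes X: "banach_over sX" and Y: "banach_over sY"
    and K: "K \<in> P_Phi_plus sX sY" and L: "L \<in> bounded_ops sY sY" and T: "T \<in> Phi_plus sX sY"
  shows "(\<lambda>x. T x - L (K x)) \<in> Phi_plus sX sY"
proof -
  interpret Y: banach_over sY by fact
  interpret L: bounded_linear L using bounded_opsD[OF L] by blast
  have Kop: "K \<in> bounded_ops sX sY"
    and pert: "\<And>R. R \<in> Phi_plus sX sY \<Longrightarrow> (\<lambda>x. R x + K x) \<in> Phi_plus sX sY"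
    using K by (auto simp: P_Phi_plus_def)
  obtain t B where t: "t > 0" and B: "bounded_linear B"
    "\<And>y. B y - t *\<^sub>R L (B y) = y" "\<And>y. B (y - t *\<^sub>R L y) = y"
    using neumann_inverse[OF L.bounded_linear_axioms] by blast
  interpret B: bounded_linear B by fact
  note T' = bounded_opsD[OF Phi_plus_bounded_ops[OF T]]
  have A: "bounded_linear (\<lambda>y. y - t *\<^sub>R L y)"
    by (intro bounded_linear_sub bounded_linear_ident bounded_linear_const_scaleR
        L.bounded_linear_axioms)
  have Bs: "B (sY k y) = sY k (B y)" for k y
  proof -
    have "sY k (B y) - t *\<^sub>R L (sY k (B y)) = sY k (B y - t *\<^sub>R L (B y))"
      by (simp add: bounded_opsD(3)[OF L] Y.scale_scaleR Y.scale_right_diff_distrib)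
    then have "sY k (B y) - t *\<^sub>R L (sY k (B y)) = sY k y" by (simp only: B)
    then show ?thesis using B(3) by metis
  qed
  define R1 where "R1 x = B (t *\<^sub>R T x)" for x
  have R1_lin: "bounded_linear R1"
    unfolding R1_def
    by (intro bounded_linear_compose[OF B(1)] bounded_linear_const_scaleR T')
  have R1: "R1 \<in> Phi_plus sX sY"
  proof (rule Phi_plus_right_factor[OF X T])
    show "R1 \<in> bounded_ops sX sY"
      using R1_lin by (intro bounded_opsI X Y) (simp_all add: R1_def T' Bs flip: Y.scale_scaleR)
    show "bounded_linear (\<lambda>y. (1 / t) *\<^sub>R (y - t *\<^sub>R L y))"
      by (intro bounded_linear_const_scaleR A)
    show "(1 / t) *\<^sub>R (R1 x - t *\<^sub>R L (R1 x)) = T x" for x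
      using t by (simp only: R1_def B) simp
  qed
  define R2 where "R2 x = - t *\<^sub>R T x + t *\<^sub>R L (K x) - K x" for x
  have R2_eq: "R2 x = - ((R1 x + K x) - t *\<^sub>R L (R1 x + K x))" for x
  proof -
    have "(R1 x + K x) - t *\<^sub>R L (R1 x + K x) = (R1 x - t *\<^sub>R L (R1 x)) + (K x - t *\<^sub>R L (K x))"
      by (simp add: L.add algebra_simps)
    also have "\<dots> = t *\<^sub>R T x + (K x - t *\<^sub>R L (K x))" by (simp only: R1_def B)
    finally show ?thesis by (simp add: R2_def algebra_simps)
  qed
  have R2_lin: "bounded_linear R2"
    unfolding R2_def
    by (intro bounded_linear_sub bounded_linear_add bounded_linear_const_scaleR
        bounded_linear_compose[OF L.bounded_linear_axioms] T' bounded_opsD[OF Kop])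
  have R2: "R2 \<in> Phi_plus sX sY"
  proof (rule Phi_plus_right_factor[OF X pert[OF R1]])
    show "R2 \<in> bounded_ops sX sY"
      using R2_lin
      by (intro bounded_opsI X Y)
        (simp_all add: R2_def T' bounded_opsD(3)[OF Kop] bounded_opsD(3)[OF L]
          Y.scale_scaleR Y.scale_right_diff_distrib Y.scale_right_distrib)
    show "bounded_linear (\<lambda>y. B (- y))"
      by (intro bounded_linear_compose[OF B(1)] bounded_linear_minus bounded_linear_ident)
    show "B (- R2 x) = R1 x + K x" for x
      by (simp only: R2_eq minus_minus B)
  qed
  show ?thesis
  proof (rule Phi_plus_right_factor[OF X pert[OF R2]])
    show "(\<lambda>x. T x - L (K x)) \<in> bounded_ops sX sY"
      by (intro bounded_opsI X Y bounded_linear_sub T'(1)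
          bounded_linear_compose[OF L.bounded_linear_axioms] bounded_opsD(1)[OF Kop])
        (simp add: T' bounded_opsD(3)[OF Kop] bounded_opsD(3)[OF L] Y.scale_right_diff_distrib)
    show "bounded_linear (\<lambda>y::'b. (- t) *\<^sub>R y)"
      by (intro bounded_linear_const_scaleR bounded_linear_ident)
    show "(- t) *\<^sub>R (T x - L (K x)) = R2 x + K x" for x
      by (simp add: R2_def algebra_simps)
  qed
qed

text \<open>
  The operator \<open>T\<close> is the difference of the two components of \<open>(T + K, K)\<close>.
\<close>

lemma Phi_singular_subset_P_Phi_plus:
  fixes sX :: "'k::{real_normed_field,euclidean_space} \<Rightarrow> 'a::banach \<Rightarrow> 'a"
    and sY :: "'k \<Rightarrow> 'b::banach \<Rightarrow> 'b"
  assumes X: "banach_over sX" and Y: "banach_over sY"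
  shows "Phi_singular sX sY \<subseteq> P_Phi_plus sX sY"
proof
  interpret Y: banach_over sY by fact
  fix K assume "K \<in> Phi_singular sX sY"
  then have K: "K \<in> bounded_ops sX sY"
    and sing: "\<And>S. S \<in> bounded_ops sX sY \<Longrightarrow>
      (\<lambda>x. (S x, K x)) \<in> Phi_plus sX (square_scale sY) \<Longrightarrow> S \<in> Phi_plus sX sY"
    by (auto simp: Phi_singular_def)
  have "(\<lambda>x. T x + K x) \<in> Phi_plus sX sY" if T: "T \<in> Phi_plus sX sY" for T
  proof (rule sing)
    have op: "(\<lambda>x. T x + K x) \<in> bounded_ops sX sY"
      using bounded_opsD[OF Phi_plus_bounded_ops[OF T]] bounded_opsD[OF K]
      by (intro bounded_opsI X Y bounded_linear_add) (auto simp: Y.scale_right_distrib)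
    then show "(\<lambda>x. T x + K x) \<in> bounded_ops sX sY" .
    show "(\<lambda>x. (T x + K x, K x)) \<in> Phi_plus sX (square_scale sY)"
    proof (rule Phi_plus_right_factor[OF X T Pair_bounded_ops[OF X Y op K]])
      show "bounded_linear (\<lambda>p :: 'b \<times> 'b. fst p - snd p)"
        by (intro bounded_linear_sub bounded_linear_fst bounded_linear_snd)
    qed simp
  qed
  then show "K \<in> P_Phi_plus sX sY" using K by (simp add: P_Phi_plus_def)
qed

text \<open>
  The isomorphism \<open>V\<close> moves \<open>(S, K)\<close> into operators from \<open>X\<close> to \<open>Y\<close>. There, subtracting
  \<open>V (0, K)\<close>, a left multiple of \<open>K\<close>, is harmless, and what remains is \<open>V (S, 0)\<close>.
\<close>

lemma P_Phi_plus_subset_Phi_singular: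
  fixes sX :: "'k::{real_normed_field,euclidean_space} \<Rightarrow> 'a::banach \<Rightarrow> 'a"
    and sY :: "'k \<Rightarrow> 'b::banach \<Rightarrow> 'b"
  assumes X: "banach_over sX" and Y: "banach_over sY"
    and iso: "isomorphic_banach (square_scale sY) sY"
  shows "P_Phi_plus sX sY \<subseteq> Phi_singular sX sY"
proof
  fix K assume KP: "K \<in> P_Phi_plus sX sY"
  then have K: "K \<in> bounded_ops sX sY" by (simp add: P_Phi_plus_def)
  obtain V where V: "V \<in> bounded_ops (square_scale sY) sY" "bij V"
    and V': "inv V \<in> bounded_ops sY (square_scale sY)"
    using iso unfolding isomorphic_banach_def by blast
  interpret Y: banach_over sY by fact
  interpret V: bounded_linear V using bounded_opsD[OF V(1)] by blast
  have sV: "V (sY k a, sY k b) = sY k (V (a, b))" for k a b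
    using bounded_opsD(3)[OF V(1), of k "(a, b)"] by (simp add: square_scale_eq[OF Y])
  have "S \<in> Phi_plus sX sY"
    if S: "S \<in> bounded_ops sX sY" and SK: "(\<lambda>x. (S x, K x)) \<in> Phi_plus sX (square_scale sY)" for S
  proof -
    note S' = bounded_opsD[OF S] and K' = bounded_opsD[OF K]
    have VSK: "(\<lambda>x. V (S x, K x)) \<in> Phi_plus sX sY"
    proof (rule Phi_plus_right_factor[OF X SK])
      show "(\<lambda>x. V (S x, K x)) \<in> bounded_ops sX sY"
        by (intro bounded_opsI X Y bounded_linear_compose[OF V.bounded_linear_axioms]
            bounded_linear_Pair S'(1) K'(1)) (simp add: S' K' sV)
      show "bounded_linear (inv V)" using bounded_opsD[OF V'] by blast
      show "inv V (V (S x, K x)) = (S x, K x)" for x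
        using V(2) by (simp add: bij_is_inj)
    qed
    have L: "(\<lambda>y. V (0, y)) \<in> bounded_ops sY sY"
    proof (intro bounded_opsI Y bounded_linear_compose[OF V.bounded_linear_axioms]
          bounded_linear_Pair bounded_linear_zero bounded_linear_ident)
      show "V (0, sY k y) = sY k (V (0, y))" for k y using sV[of k 0 y] by simp
    qed
    have VS: "(\<lambda>x. V (S x, 0)) \<in> Phi_plus sX sY"
    proof -
      have "V (S x, K x) - V (0, K x) = V (S x, 0)" for x by (simp flip: V.diff)
      then show ?thesis using Phi_plus_diff_image_of_perturbation[OF X Y KP L VSK] by simp
    qed
    have "bounded_linear (\<lambda>y. V (y, 0))"
      by (intro bounded_linear_compose[OF V.bounded_linear_axioms] bounded_linear_Pair
          bounded_linear_zero bounded_linear_ident)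
    from Phi_plus_right_factor[OF X VS S this] show ?thesis by simp
  qed
  then show "K \<in> Phi_singular sX sY" using K by (simp add: Phi_singular_def)
qed

text \<open>
  The pair is bounded below by \<open>c\<close> on a subspace of finite codimension. If \<open>S\<close> were not
  semi-Fredholm, it would be bounded by \<open>c / 2\<close> on an infinite-dimensional closed part of that subspace,
  and \<open>K\<close> would have to be bounded below by \<open>c / 2\<close> there.
\<close>

lemma strictly_singular_subset_Phi_singular:
  fixes sX :: "'k::{real_normed_field,euclidean_space} \<Rightarrow> 'a::banach \<Rightarrow> 'a"
    and sY :: "'k \<Rightarrow> 'b::banach \<Rightarrow> 'b"
  assumes X: "banach_over sX" and Y: "banach_over sY"
  shows "strictly_singular sX sY \<subseteq> Phi_singular sX sY"
proof
  interpret X: banach_over sX by fact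
  fix K assume Kss: "K \<in> strictly_singular sX sY"
  then have K: "K \<in> bounded_ops sX sY" by (simp add: strictly_singular_def)
  have "S \<in> Phi_plus sX sY"
    if S: "S \<in> bounded_ops sX sY" and SK: "(\<lambda>x. (S x, K x)) \<in> Phi_plus sX (square_scale sY)" for S
  proof (rule ccontr)
    assume "S \<notin> Phi_plus sX sY"
    then have np: "\<not> proper_on UNIV S" using Phi_plus_iff_proper[OF X S] by blast
    have SKop: "(\<lambda>x. (S x, K x)) \<in> bounded_ops sX (square_scale sY)"
      by (rule Phi_plus_bounded_ops[OF SK])
    have "proper_on UNIV (\<lambda>x. (S x, K x))"
      using Phi_plus_iff_proper[OF X SKop] SK by blast
    from X.proper_bounded_below_on_kernels[OF bounded_opsD(1)[OF SKop] this]
    obtain G c where G: "finite G" "\<And>g. g \<in> G \<Longrightarrow> bounded_linear (g :: 'a \<Rightarrow> real)" and c: "c > 0"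
      and below: "\<And>x. (\<forall>g\<in>G. \<forall>a. g (sX a x) = 0) \<Longrightarrow> c * norm x \<le> norm (S x, K x)"
      by blast
    obtain M where M: "closed_subspace sX M" "\<not> finite_dim sX M"
      "\<And>m g. m \<in> M \<Longrightarrow> g \<in> G \<Longrightarrow> g m = 0" "\<And>m. m \<in> M \<Longrightarrow> norm (S m) \<le> c / 2 * norm m"
      using X.not_proper_small_subspace[OF Y S np G, of "c / 2"] c by auto
    have "c / 2 * norm m \<le> norm (K m)" if m: "m \<in> M" for m
    proof -
      have "sX a m \<in> M" for a
        using M(1) m by (simp add: closed_subspace_def X.subspace_scale)
      then have "c * norm m \<le> norm (S m, K m)" using below M(3) by blast
      also have "\<dots> \<le> norm (S m) + norm (K m)" by (rule norm_Pair_le)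
      finally show ?thesis using M(4)[OF m] by simp
    qed
    moreover have "c / 2 > 0" using c by simp
    ultimately show False using Kss M(1,2) unfolding strictly_singular_def by blast
  qed
  then show "K \<in> Phi_singular sX sY" using K by (simp add: Phi_singular_def)
qed

lemma quotient_norm_coset:
  assumes "0 \<in> N"
  shows "0 \<le> quotient_norm (coset N x)" and "n \<in> N \<Longrightarrow> quotient_norm (coset N x) \<le> norm (x + n)"
    and "(\<And>n. n \<in> N \<Longrightarrow> l \<le> norm (x + n)) \<Longrightarrow> l \<le> quotient_norm (coset N x)"
proof -
  have "bdd_below (norm ` coset N x)" by (rule bdd_belowI2[of _ 0]) simp
  then show "quotient_norm (coset N x) \<le> norm (x + n)" if "n \<in> N"
    unfolding quotient_norm_def coset_def using that by (intro cInf_lower) auto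
  have ne: "norm ` coset N x \<noteq> {}" using assms by (auto simp: coset_def)
  show "l \<le> quotient_norm (coset N x)" if "\<And>n. n \<in> N \<Longrightarrow> l \<le> norm (x + n)" for l
    unfolding quotient_norm_def using ne that by (intro cInf_greatest) (auto simp: coset_def)
  from this[of 0] show "0 \<le> quotient_norm (coset N x)" by simp
qed

text \<open>
  The quotient map followed by the embedding.
\<close>

lemma quotient_embedding_operator:
  fixes sX :: "'k::{real_normed_field,euclidean_space} \<Rightarrow> 'a::banach \<Rightarrow> 'a"
    and sY :: "'k \<Rightarrow> 'b::banach \<Rightarrow> 'b"
  assumes X: "banach_over sX" and Y: "banach_over sY"
    and N: "closed_subspace sX N" and emb: "quotient_embeds sX N sY"
  obtains S d where "S \<in> bounded_ops sX sY" "d > 0" "\<And>x. d * quotient_norm (coset N x) \<le> norm (S x)"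
    "\<And>n. n \<in> N \<Longrightarrow> S n = 0"
proof -
  interpret X: banach_over sX by fact
  interpret Y: banach_over sY by fact
  have sub: "X.subspace N" using N by (simp add: closed_subspace_def)
  have N0: "0 \<in> N" using sub by (rule X.subspace_0)
  note ops = quotient_operations[OF X sub] and qn = quotient_norm_coset[OF N0]
  obtain U b d where U: "\<And>x y. U (coset N (x + y)) = U (coset N x) + U (coset N y)"
      "\<And>k x. U (coset N (sX k x)) = sY k (U (coset N x))"
      "\<And>x. norm (U (coset N x)) \<le> b * quotient_norm (coset N x)"
    and d: "d > 0" "\<And>x. d * quotient_norm (coset N x) \<le> norm (U (coset N x))"
    using emb unfolding quotient_embeds_def quotient_space_def by (auto simp: ops)
  define S where "S x = U (coset N x)" for x
  have bound: "norm (S x) \<le> \<bar>b\<bar> * norm (x + n)" if "n \<in> N" for x n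
  proof -
    have "norm (S x) \<le> b * quotient_norm (coset N x)" using U(3) by (simp add: S_def)
    also have "\<dots> \<le> \<bar>b\<bar> * norm (x + n)"
      using qn(1) qn(2)[OF that] by (intro mult_mono) auto
    finally show ?thesis .
  qed
  have "bounded_linear S"
  proof (rule bounded_linear_intro)
    show "S (x + y) = S x + S y" for x y by (simp add: S_def U)
    show "S (r *\<^sub>R x) = r *\<^sub>R S x" for r x
      using U(2)[of "of_real r" x] by (simp add: S_def X.scale_of_real Y.scale_of_real)
    show "norm (S x) \<le> norm x * \<bar>b\<bar>" for x using bound[OF N0] by (simp add: mult.commute)
  qed
  then have "S \<in> bounded_ops sX sY"
    by (intro bounded_opsI X Y) (auto simp: S_def U)
  moreover have "S n = 0" if "n \<in> N" for n
    using bound[of "- n" n] X.subspace_neg[OF sub that] by simp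
  ultimately show thesis using that d by (simp add: S_def)
qed

lemma not_Phi_plus_if_zero_on_infinite_dim:
  fixes sX :: "'k::{real_normed_field,euclidean_space} \<Rightarrow> 'a::banach \<Rightarrow> 'a"
    and sY :: "'k \<Rightarrow> 'b::banach \<Rightarrow> 'b"
  assumes X: "banach_over sX" and N: "closed_subspace sX N" "\<not> finite_dim sX N"
    and zero: "\<And>n. n \<in> N \<Longrightarrow> S n = 0"
  shows "S \<notin> Phi_plus sX sY"
proof
  assume S: "S \<in> Phi_plus sX sY"
  have proper: "proper_on UNIV S"
    using Phi_plus_iff_proper[OF X Phi_plus_bounded_ops[OF S]] S by blast
  have "\<exists>r. strict_mono r \<and> convergent (\<lambda>n. x (r n))"
    if x: "range x \<subseteq> N" "bounded (range x)" for x :: "nat \<Rightarrow> 'a"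
  proof -
    have "x n \<in> N" for n using x(1) by blast
    then have "convergent (\<lambda>n. S (x n))" by (simp add: zero convergent_const)
    then show ?thesis using proper x(2) unfolding proper_on_def by blast
  qed
  then show False using N(2) banach_over.finite_dim_iff_compact[OF X N(1)] by blast
qed

text \<open>
  Let \<open>K\<close> be bounded below on \<open>M\<close>, and let \<open>S\<close> be the quotient map by \<open>N\<close> followed by its embedding.
  Then \<open>S\<close> controls the distance to \<open>N\<close> while \<open>K\<close> controls the norm on \<open>N\<close>, so the pair \<open>(S, K)\<close> is
  bounded below, although \<open>S\<close> vanishes on the infinite-dimensional space \<open>N\<close>.
\<close>

lemma Phi_singular_subset_strictly_singular:
  fixes sX :: "'k::{real_normed_field,euclidean_space} \<Rightarrow> 'a::banach \<Rightarrow> 'a"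
    and sY :: "'k \<Rightarrow> 'b::banach \<Rightarrow> 'b"
  assumes X: "banach_over sX" and Y: "banach_over sY"
    and quot: "\<And>M. closed_subspace sX M \<Longrightarrow> \<not> finite_dim sX M \<Longrightarrow>
      \<exists>N\<subseteq>M. closed_subspace sX N \<and> \<not> finite_dim sX N \<and> quotient_embeds sX N sY"
  shows "Phi_singular sX sY \<subseteq> strictly_singular sX sY"
proof
  interpret X: banach_over sX by fact
  fix K assume Ksing: "K \<in> Phi_singular sX sY"
  then have K: "K \<in> bounded_ops sX sY" by (simp add: Phi_singular_def)
  interpret K: bounded_linear K using bounded_opsD[OF K] by blast
  have False
    if M: "closed_subspace sX M" "\<not> finite_dim sX M" and c: "c > 0"
      and below: "\<And>m. m \<in> M \<Longrightarrow> c * norm m \<le> norm (K m)" for M c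
  proof -
    obtain N where N: "N \<subseteq> M" "closed_subspace sX N" "\<not> finite_dim sX N" "quotient_embeds sX N sY"
      using quot[OF M] by blast
    have N0: "0 \<in> N" using N(2) X.subspace_0 by (simp add: closed_subspace_def)
    obtain S d where S: "S \<in> bounded_ops sX sY" and d: "d > 0"
        "\<And>x. d * quotient_norm (coset N x) \<le> norm (S x)"
      and zero: "\<And>n. n \<in> N \<Longrightarrow> S n = 0"
      using quotient_embedding_operator[OF X Y N(2,4)] by blast
    obtain k where k: "k > 0" "\<And>x. norm (K x) \<le> norm x * k" using K.pos_bounded by blast
    \<comment> \<open>the distance of \<open>x\<close> to \<open>N\<close>, at most \<open>norm (S x) / d\<close>, enters the estimate below with factor \<open>c + k\<close>\<close>
    define C where "C = (c + k) / d + 1"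
    have C: "C > 0" using c k d by (simp add: C_def add_pos_pos)
    have lower: "c / C * norm x \<le> norm (S x, K x)" for x
    proof -
      have "(c * norm x - norm (K x)) / (c + k) \<le> norm (x + n)" if n: "n \<in> N" for n
      proof -
        have "norm x \<le> norm (x + n) + norm n" by (metis add_diff_cancel_right' norm_triangle_ineq4)
        then have "c * norm x \<le> c * norm (x + n) + c * norm n"
          using c by (metis distrib_left mult_le_cancel_left_pos)
        also have "c * norm n \<le> norm (K n)" using below n N(1) by blast
        also have "norm (K n) = norm (K (x + n) - K x)" by (simp add: K.add)
        also have "\<dots> \<le> norm (x + n) * k + norm (K x)"
          using norm_triangle_ineq4[of "K (x + n)" "K x"] k(2)[of "x + n"] by simp
        finally have "c * norm x - norm (K x) \<le> (c + k) * norm (x + n)" by (simp add: algebra_simps)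
        then show ?thesis using c k by (simp add: field_simps)
      qed
      then have "(c * norm x - norm (K x)) / (c + k) \<le> quotient_norm (coset N x)"
        by (rule quotient_norm_coset(3)[OF N0])
      also have "\<dots> \<le> norm (S x) / d" using d(2)[of x] d(1) by (simp add: field_simps)
      finally have "c * norm x - norm (K x) \<le> (c + k) * (norm (S x) / d)"
        using c k by (simp add: pos_divide_le_eq mult.commute)
      then have "c * norm x \<le> (c + k) / d * norm (S x) + norm (K x)" by simp
      also have "\<dots> \<le> (c + k) / d * norm (S x, K x) + norm (S x, K x)"
        using c k d norm_fst_le[of "S x" "K x"] norm_snd_le[of "K x" "S x"]
        by (intro add_mono mult_left_mono) auto
      also have "\<dots> = C * norm (S x, K x)" by (simp add: C_def algebra_simps)
      finally show ?thesis using C by (simp add: field_simps)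
    qed
    have SK: "(\<lambda>x. (S x, K x)) \<in> bounded_ops sX (square_scale sY)"
      by (rule Pair_bounded_ops[OF X Y S K])
    have "proper_on UNIV (\<lambda>x. (S x, K x))"
      by (rule bounded_below_imp_proper_on[OF bounded_opsD(1)[OF SK] _ _ lower])
        (use c C in auto)
    then have "S \<in> Phi_plus sX sY"
      using Phi_plus_iff_proper[OF X SK] Ksing S unfolding Phi_singular_def by blast
    then show False using not_Phi_plus_if_zero_on_infinite_dim[where S = S, OF X N(2,3)] zero by blast
  qed
  then show "K \<in> strictly_singular sX sY"
    using K unfolding strictly_singular_def by blast
qed

theorem theorem3p4:
  fixes sX :: "'k::{real_normed_field,euclidean_space} \<Rightarrow> 'a::banach \<Rightarrow> 'a"
    and sY :: "'k \<Rightarrow> 'b::banach \<Rightarrow> 'b"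
  assumes "banach_over sX" and "banach_over sY"
    and "Phi_plus sX sY \<noteq> {}"
  shows "(isomorphic_banach (square_scale sY) sY \<longrightarrow>
            Phi_singular sX sY = P_Phi_plus sX sY) \<and>
         ((\<forall>M. closed_subspace sX M \<and> \<not> finite_dim sX M \<longrightarrow>
              (\<exists>N\<subseteq>M. closed_subspace sX N \<and> \<not> finite_dim sX N \<and> quotient_embeds sX N sY)) \<longrightarrow>
            strictly_singular sX sY = Phi_singular sX sY)"
proof (intro conjI impI)
  assume "isomorphic_banach (square_scale sY) sY"
  then show "Phi_singular sX sY = P_Phi_plus sX sY"
    using Phi_singular_subset_P_Phi_plus P_Phi_plus_subset_Phi_singular assms(1,2) by blast
next
  assume "\<forall>M. closed_subspace sX M \<and> \<not> finite_dim sX M \<longrightarrow>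
    (\<exists>N\<subseteq>M. closed_subspace sX N \<and> \<not> finite_dim sX N \<and> quotient_embeds sX N sY)"
  then have "Phi_singular sX sY \<subseteq> strictly_singular sX sY"
    by (intro Phi_singular_subset_strictly_singular assms(1,2)) blast
  then show "strictly_singular sX sY = Phi_singular sX sY"
    using strictly_singular_subset_Phi_singular[OF assms(1,2)] by blast
qed

end
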